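(* The category $\mathrm{Bio}$ of closed bios and maps of bios is complete and cocomplete.
   Context: A **bio** (bi-operad) $P=(P^-,P^\circ,P^+)$ consists of a set $P^\circ$ of objects and, for all $n\ge 0$ and $c_0,\dots,c_n\in P^\circ$, sets $P^-(c_0;c_1,\dots,c_n)$ (operations) and $P^+(c_1,\dots,c_n;c_0)$ (co-operations), with the following structure. (i) Symmetric group actions: for $\sigma\in S_n$, maps $P^-(c_0;c_1,\dots,c_n)\to P^-(c_0;c_{\sigma(1)},\dots,c_{\sigma(n)})$, $p\mapsto p\sigma$, and $P^+(c_1,\dots,c_n;c_0)\to P^+(c_{\sigma^{-1}(1)},\dots,c_{\sigma^{-1}(n)};c_0)$, $p\mapsto\sigma p$. (ii) Units $1_c^-\in P^-(c;c)$, $1_c^+\in P^+(c;c)$. (iii) Compositions: for words $\bar c_i=(c_{i1},\dots,c_{im_i})$, $m_i\ge0$, with concatenation $\bar c=\bar c_1\cdots\bar c_n$, and objects $b_0,\dots,b_n$: $$\circ:P^-(b_0;b_1,\dots,b_n)\times\prod_iP^-(b_i;\bar c_i)\to P^-(b_0;\bar c),\qquad \circ:\prod_iP^+(\bar c_i;b_i)\times P^+(b_1,\dots,b_n;b_0)\to P^+(\bar c;b_0),$$ associative, unital, and equivariant (so $P^-$ and $P^+$ are coloured symmetric operads on the same set of colours). (iv) Mutual actions: for such words, with all $m_i\ge1$, $$\overrightarrow\circ:\prod_iP^-(b_i;\bar c_i)\times P^+(\bar c;b_0)\to P^+(b_1,\dots,b_n;b_0),\qquad \overleftarrow\circ:P^-(b_0;\bar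 c)\times\prod_iP^+(\bar c_i;b_i)\to P^-(b_0;b_1,\dots,b_n),$$ which are $S_n$-covariant and $S_{m_1}\times\dots\times S_{m_n}$-invariant (simultaneously permuting the matched inputs within the words $\bar c_i$ does not change the result), and satisfy, whenever the expressions are defined: - unitality: $p\overleftarrow\circ(1^+_{c_i})=p$ and $(1^-_{c_i})\overrightarrow\circ p=p$; - associativity: $(p\overleftarrow\circ(p_{ij}))\overleftarrow\circ(p_j)=p\overleftarrow\circ((p_{ij})\circ p_j)$ and $(p_i)\overrightarrow\circ((p_{ij})\overrightarrow\circ p)=(p_i\circ(p_{ij}))\overrightarrow\circ p$; - linearity: $(p\circ(p_i))\overleftarrow\circ(p_{ij})=p\circ(p_i\overleftarrow\circ(p_{ij}))$; $(p_{ij})\overrightarrow\circ((p_j)\circ p)=((p_{ij})\overrightarrow\circ p_j)\circ p$; $p\overleftarrow\circ((p_{ij})\overrightarrow\circ p_j)=(p\circ(p_{ij}))\overleftarrow\circ(p_j)$; $(p_i\overleftarrow\circ(p_{ij}))\overrightarrow\circ p=(p_i)\overrightarrow\circ((p_{ij})\circ p)$. A **map of bios** $\varphi:P\to Q$ is a map $\varphi^\circ:P^\circ\to Q^\circ$ together with maps of operads $\varphi^\pm:P^\pm\to Q^\pm$ over $\varphi^\circ$ preserving both mutual actions: $\varphi^-(p\overleftarrow\circ(p_i))=\varphi^-(p)\overleftarrow\circ(\varphi^+(p_i))$ and $\varphi^+((p_i)\overrightarrow\circ p)=(\varphi^-(p_i))\overrightarrow\circ\varphi^+(p)$. A bio is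 **closed** if $P^-(b;\emptyset)$ and $P^+(\emptyset;b)$ (the case $n=0$) are one-point sets for every object $b$. $\mathrm{Bio}$ denotes the category of (small) closed bios. *)

theory Defs
  imports "HOL-Combinatorics.Permutations"
begin

section \<open>Permutations of concatenated words\<close>

text \<open>
  Permutations of $n$ letters are functions with \<open>\<sigma> permutes {..<n}\<close>, and
  \<open>permute_list \<sigma> [c_1, ..., c_n]\<close> is the word $(c_{\sigma(1)},\dots,c_{\sigma(n)})$, with
  positions counted from 0.  For words of lengths \<open>ms\<close>, \<open>blocks ms\<close> lists the positions that each
  word occupies in the concatenation.  The two lemmas below say that \<open>block_perm\<close> permutes the words
  as blocks and that \<open>sum_perm\<close> permutes within each word.
\<close>

definition blocks :: "nat list \<Rightarrow> nat list list" where
  "blocks ms = map (\<lambda>i. [sum_list (take i ms) ..< sum_list (take (Suc i) ms)]) [0..<length ms]"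

definition block_perm :: "nat list \<Rightarrow> (nat \<Rightarrow> nat) \<Rightarrow> nat \<Rightarrow> nat" where
  "block_perm ms \<sigma> k =
    (if k < sum_list ms then concat (permute_list \<sigma> (blocks ms)) ! k else k)"

definition sum_perm :: "nat list \<Rightarrow> (nat \<Rightarrow> nat) list \<Rightarrow> nat \<Rightarrow> nat" where
  "sum_perm ms \<tau>s k =
    (if k < sum_list ms then concat (map2 permute_list \<tau>s (blocks ms)) ! k else k)"

lemma length_blocks [simp]: "length (blocks ms) = length ms"
  by (simp add: blocks_def)

lemma map_nth_blocks:
  assumes "i < length css"
  shows "map ((!) (concat css)) (blocks (map length css) ! i) = css ! i"
proof -
  have len: "sum_list (take k (map length css)) = length (concat (take k css))" for k
    by (simp add: length_concat take_map)
  have split: "concat css = concat (take i css) @ css ! i @ concat (drop (Suc i) css)"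
    using assms by (metis concat.simps(2) concat_append id_take_nth_drop)
  have "length (concat (take (Suc i) css)) = length (concat (take i css)) + length (css ! i)"
    using assms by (simp add: take_Suc_conv_app_nth)
  then show ?thesis
    unfolding blocks_def using assms
    by (intro nth_equalityI) (auto simp: len split nth_append)
qed

lemma map_blocks: "map (map ((!) (concat css))) (blocks (map length css)) = css"
  by (rule nth_equalityI) (auto simp: map_nth_blocks)

lemma permute_list_eqI:
  assumes "length ks = length xs" "\<And>i. i < length xs \<Longrightarrow> f i = ks ! i"
  shows "permute_list f xs = map ((!) xs) ks"
  using assms by (intro nth_equalityI) (simp_all add: permute_list_def)

lemma permute_list_block_perm:
  assumes "\<sigma> permutes {..<length css}"
  shows "permute_list (block_perm (map length css) \<sigma>) (concat css) = concat (permute_list \<sigma> css)"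
proof -
  let ?bs = "blocks (map length css)"
  have *: "concat (permute_list \<sigma> css) = map ((!) (concat css)) (concat (permute_list \<sigma> ?bs))"
    using assms by (subst (1) map_blocks [symmetric])
      (simp add: permute_list_map map_concat)
  have "mset (permute_list \<sigma> css) = mset css"
    using assms by simp
  then have "length (concat (permute_list \<sigma> css)) = length (concat css)"
    by (metis length_concat mset_map sum_mset_sum_list)
  with * show ?thesis
    by (simp only: *) (rule permute_list_eqI, simp_all add: block_perm_def length_concat)
qed

lemma permute_list_sum_perm:
  assumes "length \<tau>s = length css" "\<And>i. i < length css \<Longrightarrow> \<tau>s ! i permutes {..<length (css ! i)}"
  shows "permute_list (sum_perm (map length css) \<tau>s) (concat css) = concat (map2 permute_list \<tau>s css)"
proof -
  let ?bs = "blocks (map length css)"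
  have lenb: "length (?bs ! i) = length (css ! i)" if "i < length css" for i
    using map_nth_blocks [OF that] by (metis length_map)
  have "map2 permute_list \<tau>s css = map (map ((!) (concat css))) (map2 permute_list \<tau>s ?bs)"
    using assms
    by (intro nth_equalityI)
      (simp_all add: lenb map_nth_blocks flip: permute_list_map)
  then have *: "concat (map2 permute_list \<tau>s css) =
      map ((!) (concat css)) (concat (map2 permute_list \<tau>s ?bs))"
    by (simp add: map_concat)
  have "map length (map2 permute_list \<tau>s css) = map length css"
    using assms by (intro nth_equalityI) simp_all
  then have "length (concat (map2 permute_list \<tau>s css)) = length (concat css)"
    by (simp only: length_concat)
  with * show ?thesis
    by (simp only: *) (rule permute_list_eqI, simp_all add: sum_perm_def length_concat)
qed


section \<open>Coloured symmetric operads\<close>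

text \<open>
  The sets \<open>Ops P c cs\<close> are indexed by a colour and a word of colours and need not be disjoint,
  so every structure map takes the relevant profiles as arguments.  \<open>comp_op P a bs css p ps\<close> is
  $p\circ(p_1,\dots,p_n)$ for $p\in P(a;b_1,\dots,b_n)$ and $p_i\in P(b_i;\bar c_i)$.
\<close>

record ('c, 'o) operad =
  Ops :: "'c \<Rightarrow> 'c list \<Rightarrow> 'o set"
  act :: "'c \<Rightarrow> 'c list \<Rightarrow> (nat \<Rightarrow> nat) \<Rightarrow> 'o \<Rightarrow> 'o"
  unit_op :: "'c \<Rightarrow> 'o"
  comp_op :: "'c \<Rightarrow> 'c list \<Rightarrow> 'c list list \<Rightarrow> 'o \<Rightarrow> 'o list \<Rightarrow> 'o"

text \<open>The product $\prod_i P(b_i;\bar c_i)$.\<close>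

definition multi_ops :: "('c, 'o) operad \<Rightarrow> 'c list \<Rightarrow> 'c list list \<Rightarrow> 'o list set" where
  "multi_ops P bs css = {ps. length css = length bs \<and> length ps = length bs \<and>
    (\<forall>i<length bs. ps ! i \<in> Ops P (bs ! i) (css ! i))}"

text \<open>The double product $\prod_i\prod_j P(c_{ij};\bar d_{ij})$.\<close>

definition multi_multi_ops ::
    "('c, 'o) operad \<Rightarrow> 'c list list \<Rightarrow> 'c list list list \<Rightarrow> 'o list list set" where
  "multi_multi_ops P css dsss = {pss. length dsss = length css \<and> length pss = length css \<and>
    (\<forall>i<length css. pss ! i \<in> multi_ops P (css ! i) (dsss ! i))}"

definition multi_act ::
    "('c, 'o) operad \<Rightarrow> 'c list \<Rightarrow> 'c list list \<Rightarrow> (nat \<Rightarrow> nat) list \<Rightarrow> 'o list \<Rightarrow> 'o list" where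
  "multi_act P bs css \<tau>s ps =
    map (\<lambda>i. act P (bs ! i) (css ! i) (\<tau>s ! i) (ps ! i)) [0..<length bs]"

definition word_perms :: "'c list list \<Rightarrow> (nat \<Rightarrow> nat) list set" where
  "word_perms css = {\<tau>s. length \<tau>s = length css \<and>
    (\<forall>i<length css. \<tau>s ! i permutes {..<length (css ! i)})}"

text \<open>
  The assumption \<open>colours\<close> is the convention that the family \<open>Ops P\<close>, defined on colours in \<open>C\<close>,
  is extended by the empty set.
\<close>

locale is_operad =
  fixes C :: "'c set" and P :: "('c, 'o) operad"
  assumes colours: "p \<in> Ops P c cs \<Longrightarrow> c \<in> C \<and> set cs \<subseteq> C"
    and act_closed:
      "\<lbrakk>p \<in> Ops P c cs; \<sigma> permutes {..<length cs}\<rbrakk> \<Longrightarrow> act P c cs \<sigma> p \<in> Ops P c (permute_list \<sigma> cs)"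
    and act_id: "p \<in> Ops P c cs \<Longrightarrow> act P c cs id p = p"
    and act_act:
      "\<lbrakk>p \<in> Ops P c cs; \<sigma> permutes {..<length cs}; \<tau> permutes {..<length cs}\<rbrakk> \<Longrightarrow>
        act P c (permute_list \<sigma> cs) \<tau> (act P c cs \<sigma> p) = act P c cs (\<sigma> \<circ> \<tau>) p"
    and unit_closed: "c \<in> C \<Longrightarrow> unit_op P c \<in> Ops P c [c]"
    and comp_closed:
      "\<lbrakk>p \<in> Ops P a bs; ps \<in> multi_ops P bs css\<rbrakk> \<Longrightarrow> comp_op P a bs css p ps \<in> Ops P a (concat css)"
    and comp_unit_left: "p \<in> Ops P c cs \<Longrightarrow> comp_op P c [c] [cs] (unit_op P c) [p] = p"
    and comp_unit_right:
      "p \<in> Ops P c cs \<Longrightarrow> comp_op P c cs (map (\<lambda>c. [c]) cs) p (map (unit_op P) cs) = p"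
    and comp_assoc:
      "\<lbrakk>p \<in> Ops P a bs; ps \<in> multi_ops P bs css; pss \<in> multi_multi_ops P css dsss\<rbrakk> \<Longrightarrow>
        comp_op P a (concat css) (concat dsss) (comp_op P a bs css p ps) (concat pss) =
        comp_op P a bs (map concat dsss) p
          (map (\<lambda>i. comp_op P (bs ! i) (css ! i) (dsss ! i) (ps ! i) (pss ! i)) [0..<length bs])"
    and comp_act_outer:
      "\<lbrakk>p \<in> Ops P a bs; ps \<in> multi_ops P bs css; \<sigma> permutes {..<length bs}\<rbrakk> \<Longrightarrow>
        comp_op P a (permute_list \<sigma> bs) (permute_list \<sigma> css) (act P a bs \<sigma> p) (permute_list \<sigma> ps) =
        act P a (concat css) (block_perm (map length css) \<sigma>) (comp_op P a bs css p ps)"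
    and comp_act_inner:
      "\<lbrakk>p \<in> Ops P a bs; ps \<in> multi_ops P bs css; \<tau>s \<in> word_perms css\<rbrakk> \<Longrightarrow>
        comp_op P a bs (map2 permute_list \<tau>s css) p (multi_act P bs css \<tau>s ps) =
        act P a (concat css) (sum_perm (map length css) \<tau>s) (comp_op P a bs css p ps)"


section \<open>Bios\<close>

text \<open>
  The co-operations are stored as an operad too: \<open>Ops (Pos B) c_0 [c_1, ..., c_n]\<close> is
  $P^+(c_1,\dots,c_n;c_0)$, \<open>comp_op (Pos B) a bs css p ps\<close> is $(p_1,\dots,p_n)\circ p$, and the left
  action of $\sigma$ is \<open>act\<close> of the inverse permutation, so that \<open>act (Pos B) c cs \<sigma> p\<close> is
  $\sigma^{-1}p\in P^+(c_{\sigma(1)},\dots,c_{\sigma(n)};c_0)$.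

  With \<open>ps\<close> the family that sits over the words \<open>css\<close>, \<open>lact B a bs css p ps\<close> is
  $p\overleftarrow\circ(p_i)$ and \<open>ract B a bs css p ps\<close> is $(p_i)\overrightarrow\circ p$.
\<close>

record ('c, 'o) bio =
  Obj :: "'c set"
  Neg :: "('c, 'o) operad"
  Pos :: "('c, 'o) operad"
  lact :: "'c \<Rightarrow> 'c list \<Rightarrow> 'c list list \<Rightarrow> 'o \<Rightarrow> 'o list \<Rightarrow> 'o"
  ract :: "'c \<Rightarrow> 'c list \<Rightarrow> 'c list list \<Rightarrow> 'o \<Rightarrow> 'o list \<Rightarrow> 'o"

text \<open>
  The axioms on the mutual actions are symmetric under exchanging operations and co-operations.
  The following locale is one half of them: \<open>\<alpha>\<close> is the action of \<open>Q\<close> on \<open>P\<close>, and \<open>\<beta>\<close>, which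
  occurs only in the second linearity law, the action of \<open>P\<close> on \<open>Q\<close>.  In the notation for
  \<open>P\<close> = $P^-$ and \<open>Q\<close> = $P^+$, the two linearity laws are
  $(p\circ(p_i))\overleftarrow\circ(q_{ij}) = p\circ(p_i\overleftarrow\circ(q_{ij}))$ and
  $p\overleftarrow\circ((p_{ij})\overrightarrow\circ q_j) = (p\circ(p_{ij}))\overleftarrow\circ(q_j)$.
\<close>

locale mutual_action = P: is_operad C P + Q: is_operad C Q
  for C :: "'c set" and P Q :: "('c, 'o) operad" +
  fixes \<alpha> \<beta> :: "'c \<Rightarrow> 'c list \<Rightarrow> 'c list list \<Rightarrow> 'o \<Rightarrow> 'o list \<Rightarrow> 'o"
  assumes closed:
      "\<lbrakk>p \<in> Ops P a (concat css); qs \<in> multi_ops Q bs css; [] \<notin> set css\<rbrakk> \<Longrightarrow>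
        \<alpha> a bs css p qs \<in> Ops P a bs"
    and covariant:
      "\<lbrakk>p \<in> Ops P a (concat css); qs \<in> multi_ops Q bs css; [] \<notin> set css;
        \<sigma> permutes {..<length bs}\<rbrakk> \<Longrightarrow>
        \<alpha> a (permute_list \<sigma> bs) (permute_list \<sigma> css)
          (act P a (concat css) (block_perm (map length css) \<sigma>) p) (permute_list \<sigma> qs) =
        act P a bs \<sigma> (\<alpha> a bs css p qs)"
    and invariant:
      "\<lbrakk>p \<in> Ops P a (concat css); qs \<in> multi_ops Q bs css; [] \<notin> set css; \<tau>s \<in> word_perms css\<rbrakk> \<Longrightarrow>
        \<alpha> a bs (map2 permute_list \<tau>s css)
          (act P a (concat css) (sum_perm (map length css) \<tau>s) p) (multi_act Q bs css \<tau>s qs) =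
        \<alpha> a bs css p qs"
    and unital:
      "p \<in> Ops P c cs \<Longrightarrow> \<alpha> c cs (map (\<lambda>c. [c]) cs) p (map (unit_op Q) cs) = p"
    and assoc:
      "\<lbrakk>p \<in> Ops P a (concat (concat dsss)); qs \<in> multi_ops Q bs css;
        qss \<in> multi_multi_ops Q css dsss; [] \<notin> set css; [] \<notin> set (concat dsss)\<rbrakk> \<Longrightarrow>
        \<alpha> a bs css (\<alpha> a (concat css) (concat dsss) p (concat qss)) qs =
        \<alpha> a bs (map concat dsss) p
          (map (\<lambda>i. comp_op Q (bs ! i) (css ! i) (dsss ! i) (qs ! i) (qss ! i)) [0..<length bs])"
    and linear_comp:
      "\<lbrakk>p \<in> Ops P a bs; ps \<in> multi_ops P bs (map concat dsss); qss \<in> multi_multi_ops Q css dsss;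
        [] \<notin> set (concat dsss)\<rbrakk> \<Longrightarrow>
        \<alpha> a (concat css) (concat dsss) (comp_op P a bs (map concat dsss) p ps) (concat qss) =
        comp_op P a bs css p
          (map (\<lambda>i. \<alpha> (bs ! i) (css ! i) (dsss ! i) (ps ! i) (qss ! i)) [0..<length bs])"
    and linear_act:
      "\<lbrakk>p \<in> Ops P a (concat css); qs \<in> multi_ops Q bs (map concat dsss);
        pss \<in> multi_multi_ops P css dsss; [] \<notin> set css; [] \<notin> set (concat dsss)\<rbrakk> \<Longrightarrow>
        \<alpha> a bs css p
          (map (\<lambda>i. \<beta> (bs ! i) (css ! i) (dsss ! i) (qs ! i) (pss ! i)) [0..<length bs]) =
        \<alpha> a bs (map concat dsss) (comp_op P a (concat css) (concat dsss) p (concat pss)) qs"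

definition is_bio :: "('c, 'o) bio \<Rightarrow> bool" where
  "is_bio B \<longleftrightarrow> mutual_action (Obj B) (Neg B) (Pos B) (lact B) (ract B) \<and>
    mutual_action (Obj B) (Pos B) (Neg B) (ract B) (lact B)"

definition closed_bio :: "('c, 'o) bio \<Rightarrow> bool" where
  "closed_bio B \<longleftrightarrow> is_bio B \<and>
    (\<forall>b\<in>Obj B. is_singleton (Ops (Neg B) b []) \<and> is_singleton (Ops (Pos B) b []))"


section \<open>Maps of bios\<close>

definition operad_map ::
    "'c set \<Rightarrow> ('c, 'o) operad \<Rightarrow> ('d, 'u) operad \<Rightarrow> ('c \<Rightarrow> 'd) \<Rightarrow> ('c \<Rightarrow> 'c list \<Rightarrow> 'o \<Rightarrow> 'u) \<Rightarrow> bool" where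
  "operad_map C P Q f \<phi> \<longleftrightarrow>
    (\<forall>c cs. \<forall>p\<in>Ops P c cs. \<phi> c cs p \<in> Ops Q (f c) (map f cs)) \<and>
    (\<forall>c cs \<sigma>. \<forall>p\<in>Ops P c cs. \<sigma> permutes {..<length cs} \<longrightarrow>
      \<phi> c (permute_list \<sigma> cs) (act P c cs \<sigma> p) = act Q (f c) (map f cs) \<sigma> (\<phi> c cs p)) \<and>
    (\<forall>c\<in>C. \<phi> c [c] (unit_op P c) = unit_op Q (f c)) \<and>
    (\<forall>a bs css. \<forall>p\<in>Ops P a bs. \<forall>ps\<in>multi_ops P bs css.
      \<phi> a (concat css) (comp_op P a bs css p ps) =
      comp_op Q (f a) (map f bs) (map (map f) css) (\<phi> a bs p)
        (map (\<lambda>i. \<phi> (bs ! i) (css ! i) (ps ! i)) [0..<length bs]))"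

text \<open>\<open>\<phi>\<close> on \<open>P\<close> and \<open>\<psi>\<close> on \<open>Q\<close> carry the action \<open>\<alpha>\<close> of \<open>Q\<close> on \<open>P\<close> to the action \<open>\<alpha>'\<close>.\<close>

definition preserves_action where
  "preserves_action P Q \<alpha> \<alpha>' f \<phi> \<psi> \<longleftrightarrow>
    (\<forall>a bs css. \<forall>p\<in>Ops P a (concat css). \<forall>qs\<in>multi_ops Q bs css. [] \<notin> set css \<longrightarrow>
      \<phi> a bs (\<alpha> a bs css p qs) =
      \<alpha>' (f a) (map f bs) (map (map f) css) (\<phi> a (concat css) p)
        (map (\<lambda>i. \<psi> (bs ! i) (css ! i) (qs ! i)) [0..<length bs]))"

record ('c, 'o, 'd, 'u) bio_map =
  obj_map :: "'c \<Rightarrow> 'd"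
  neg_map :: "'c \<Rightarrow> 'c list \<Rightarrow> 'o \<Rightarrow> 'u"
  pos_map :: "'c \<Rightarrow> 'c list \<Rightarrow> 'o \<Rightarrow> 'u"

definition is_bio_map :: "('c, 'o) bio \<Rightarrow> ('d, 'u) bio \<Rightarrow> ('c, 'o, 'd, 'u) bio_map \<Rightarrow> bool" where
  "is_bio_map B B' h \<longleftrightarrow>
    obj_map h ` Obj B \<subseteq> Obj B' \<and>
    operad_map (Obj B) (Neg B) (Neg B') (obj_map h) (neg_map h) \<and>
    operad_map (Obj B) (Pos B) (Pos B') (obj_map h) (pos_map h) \<and>
    preserves_action (Neg B) (Pos B) (lact B) (lact B') (obj_map h) (neg_map h) (pos_map h) \<and>
    preserves_action (Pos B) (Neg B) (ract B) (ract B') (obj_map h) (pos_map h) (neg_map h)"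

definition id_map :: "('c, 'o, 'c, 'o) bio_map" where
  "id_map = \<lparr>obj_map = (\<lambda>c. c), neg_map = (\<lambda>c cs p. p), pos_map = (\<lambda>c cs p. p)\<rparr>"

definition comp_map ::
    "('d, 'u, 'e, 'v) bio_map \<Rightarrow> ('c, 'o, 'd, 'u) bio_map \<Rightarrow> ('c, 'o, 'e, 'v) bio_map" where
  "comp_map g h =
    \<lparr>obj_map = obj_map g \<circ> obj_map h,
     neg_map = (\<lambda>c cs p. neg_map g (obj_map h c) (map (obj_map h) cs) (neg_map h c cs p)),
     pos_map = (\<lambda>c cs p. pos_map g (obj_map h c) (map (obj_map h) cs) (pos_map h c cs p))\<rparr>"

text \<open>
  Equality of maps with source \<open>B\<close>: the values of the underlying total functions outside \<open>B\<close>
  are irrelevant.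
\<close>

definition map_eq :: "('c, 'o) bio \<Rightarrow> ('c, 'o, 'd, 'u) bio_map \<Rightarrow> ('c, 'o, 'd, 'u) bio_map \<Rightarrow> bool" where
  "map_eq B g h \<longleftrightarrow>
    (\<forall>c\<in>Obj B. obj_map g c = obj_map h c) \<and>
    (\<forall>c cs. \<forall>p\<in>Ops (Neg B) c cs. neg_map g c cs p = neg_map h c cs p) \<and>
    (\<forall>c cs. \<forall>p\<in>Ops (Pos B) c cs. pos_map g c cs p = pos_map h c cs p)"


section \<open>Limits and colimits of small diagrams of closed bios\<close>

record ('i, 'a) cat =
  Nodes :: "'i set"
  Arrows :: "'a set"
  src :: "'a \<Rightarrow> 'i"
  tgt :: "'a \<Rightarrow> 'i"
  id_arr :: "'i \<Rightarrow> 'a"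
  comp_arr :: "'a \<Rightarrow> 'a \<Rightarrow> 'a"

locale small_category =
  fixes J :: "('i, 'a) cat"
  assumes src_tgt: "f \<in> Arrows J \<Longrightarrow> src J f \<in> Nodes J \<and> tgt J f \<in> Nodes J"
    and id_arr: "i \<in> Nodes J \<Longrightarrow>
      id_arr J i \<in> Arrows J \<and> src J (id_arr J i) = i \<and> tgt J (id_arr J i) = i"
    and comp_arr: "\<lbrakk>f \<in> Arrows J; g \<in> Arrows J; tgt J f = src J g\<rbrakk> \<Longrightarrow>
      comp_arr J g f \<in> Arrows J \<and> src J (comp_arr J g f) = src J f \<and> tgt J (comp_arr J g f) = tgt J g"
    and id_left: "f \<in> Arrows J \<Longrightarrow> comp_arr J (id_arr J (tgt J f)) f = f"
    and id_right: "f \<in> Arrows J \<Longrightarrow> comp_arr J f (id_arr J (src J f)) = f"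
    and arr_assoc:
      "\<lbrakk>f \<in> Arrows J; g \<in> Arrows J; h \<in> Arrows J; tgt J f = src J g; tgt J g = src J h\<rbrakk> \<Longrightarrow>
        comp_arr J h (comp_arr J g f) = comp_arr J (comp_arr J h g) f"

text \<open>A functor from \<open>J\<close> to closed bios, with object part \<open>D\<close> and arrow part \<open>M\<close>.\<close>

locale diagram = small_category J for J :: "('i, 'a) cat" +
  fixes D :: "'i \<Rightarrow> ('c, 'o) bio" and M :: "'a \<Rightarrow> ('c, 'o, 'c, 'o) bio_map"
  assumes node: "i \<in> Nodes J \<Longrightarrow> closed_bio (D i)"
    and arrow: "f \<in> Arrows J \<Longrightarrow> is_bio_map (D (src J f)) (D (tgt J f)) (M f)"
    and map_id: "i \<in> Nodes J \<Longrightarrow> map_eq (D i) (M (id_arr J i)) id_map"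
    and map_comp: "\<lbrakk>f \<in> Arrows J; g \<in> Arrows J; tgt J f = src J g\<rbrakk> \<Longrightarrow>
      map_eq (D (src J f)) (M (comp_arr J g f)) (comp_map (M g) (M f))"

definition is_cone where
  "is_cone J D M L \<pi> \<longleftrightarrow> closed_bio L \<and>
    (\<forall>i\<in>Nodes J. is_bio_map L (D i) (\<pi> i)) \<and>
    (\<forall>f\<in>Arrows J. map_eq L (comp_map (M f) (\<pi> (src J f))) (\<pi> (tgt J f)))"

definition is_cocone where
  "is_cocone J D M L \<iota> \<longleftrightarrow> closed_bio L \<and>
    (\<forall>i\<in>Nodes J. is_bio_map (D i) L (\<iota> i)) \<and>
    (\<forall>f\<in>Arrows J. map_eq (D (src J f)) (comp_map (\<iota> (tgt J f)) (M f)) (\<iota> (src J f)))"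

text \<open>
  HOL cannot quantify over types inside a formula, so the universal properties below take as first
  argument the type from which the test objects \<open>X\<close> are drawn.
\<close>

definition is_limit where
  "is_limit (_ :: ('x, 'y) bio itself) J D M L \<pi> \<longleftrightarrow> is_cone J D M L \<pi> \<and>
    (\<forall>(X :: ('x, 'y) bio) \<xi>. is_cone J D M X \<xi> \<longrightarrow>
      (\<exists>h. is_bio_map X L h \<and> (\<forall>i\<in>Nodes J. map_eq X (comp_map (\<pi> i) h) (\<xi> i)) \<and>
        (\<forall>h'. is_bio_map X L h' \<and> (\<forall>i\<in>Nodes J. map_eq X (comp_map (\<pi> i) h') (\<xi> i)) \<longrightarrow>
          map_eq X h h')))"

definition is_colimit where
  "is_colimit (_ :: ('x, 'y) bio itself) J D M L \<iota> \<longleftrightarrow> is_cocone J D M L \<iota> \<and>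
    (\<forall>(X :: ('x, 'y) bio) \<xi>. is_cocone J D M X \<xi> \<longrightarrow>
      (\<exists>h. is_bio_map L X h \<and> (\<forall>i\<in>Nodes J. map_eq (D i) (comp_map h (\<iota> i)) (\<xi> i)) \<and>
        (\<forall>h'. is_bio_map L X h' \<and> (\<forall>i\<in>Nodes J. map_eq (D i) (comp_map h' (\<iota> i)) (\<xi> i)) \<longrightarrow>
          map_eq L h h')))"

text \<open>
  Carriers large enough for the limit (families of elements) and the colimit (classes of finite
  terms in the elements) of a diagram indexed by \<open>'i\<close> of bios with colours in \<open>'c\<close> and operations
  in \<open>'o\<close>.  These types only bound the size of the carriers; elements of \<open>colimit_bio\<close> carry no
  prescribed meaning.
\<close>

type_synonym ('i, 'c, 'o) limit_bio = "('i \<Rightarrow> 'c, 'i \<Rightarrow> 'o) bio"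

type_synonym ('i, 'c, 'o) colimit_bio = "('i \<times> 'c, (nat + 'i \<times> ('c + 'o)) list) bio"

end

(*
  Jointly faithful families of maps into bios reflect the axioms: if such maps preserve the raw
  structure of L and the structure maps of L stay inside its carriers, then L satisfies every
  equational axiom, and maps into L are detected by their composites.  Hence the compatible families
  of a diagram form a bio, its limit.  Colimits come from the adjoint functor argument.  The sub-bio generated by
  the legs of a cocone consists of values of finite terms, so it has a copy on a fixed pair of
  carrier types; the colimit is the sub-bio generated by the diagram in the product of all cocones
  on these carriers.  It maps to any cocone X through the factor that copies the sub-bio of X
  generated by the legs, uniquely because it is itself generated by its legs.
*)

theory Submission
  imports Defs
begin

section \<open>Operations and co-operations on an equal footing\<close>

text \<open>A presentation of colimits by generators and relations would require the analysis of a
  congruence on typed, partially defined terms under all mixed laws. Here no congruence is formed: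
  equations are inherited from bios that already satisfy them, and one chosen term per value
  replaces an equivalence class. There is also a typing obstacle. Apexes of cocones range over all
  types and cannot index a product, whereas the copies of their generated parts share one pair of
  carrier types determined by the diagram. The product of these copies lives on other types, and
  passing to its own generated part is what brings it back to the prescribed carriers. Closedness
  survives both constructions: over a fixed colour the only nullary family is automatically
  compatible, and a nullary element of a generated part comes from any leg that reaches the colour.
  This is why a generated part has only the colours in the images of the legs.\<close>

text \<open>
  The sign \<open>s\<close> is \<open>True\<close> for operations and \<open>False\<close> for co-operations, so that \<open>mact s\<close> is the action
  of \<open>side (\<not> s)\<close> on \<open>side s\<close>.
\<close>

definition side :: "bool \<Rightarrow> ('c, 'o) bio \<Rightarrow> ('c, 'o) operad" where
  "side s B = (if s then Neg B else Pos B)"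

definition mact :: "bool \<Rightarrow> ('c, 'o) bio \<Rightarrow> 'c \<Rightarrow> 'c list \<Rightarrow> 'c list list \<Rightarrow> 'o \<Rightarrow> 'o list \<Rightarrow> 'o" where
  "mact s B = (if s then lact B else ract B)"

definition smap :: "bool \<Rightarrow> ('c, 'o, 'd, 'u) bio_map \<Rightarrow> 'c \<Rightarrow> 'c list \<Rightarrow> 'o \<Rightarrow> 'u" where
  "smap s h = (if s then neg_map h else pos_map h)"

text \<open>Building records from \<open>bool\<close>-indexed families lets a construction be given
  once for both signs; the simplification rules then never split into operations and
  co-operations.\<close>

definition mk_bio ::
    "'c set \<Rightarrow> (bool \<Rightarrow> ('c, 'o) operad) \<Rightarrow>
      (bool \<Rightarrow> 'c \<Rightarrow> 'c list \<Rightarrow> 'c list list \<Rightarrow> 'o \<Rightarrow> 'o list \<Rightarrow> 'o) \<Rightarrow> ('c, 'o) bio" where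
  "mk_bio C F A = \<lparr>Obj = C, Neg = F True, Pos = F False, lact = A True, ract = A False\<rparr>"

definition mk_map ::
    "('c \<Rightarrow> 'd) \<Rightarrow> (bool \<Rightarrow> 'c \<Rightarrow> 'c list \<Rightarrow> 'o \<Rightarrow> 'u) \<Rightarrow> ('c, 'o, 'd, 'u) bio_map" where
  "mk_map f \<phi> = \<lparr>obj_map = f, neg_map = \<phi> True, pos_map = \<phi> False\<rparr>"

text \<open>This is the list expression occurring in \<open>operad_map\<close> and
  \<open>preserves_action\<close>. Indexing by the positions of \<open>bs\<close>, instead of
  zipping, makes its length and entries computable without hypotheses on the other two
  lists.\<close>

definition mmap :: "('c \<Rightarrow> 'd \<Rightarrow> 'o \<Rightarrow> 'u) \<Rightarrow> 'c list \<Rightarrow> 'd list \<Rightarrow> 'o list \<Rightarrow> 'u list" where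
  "mmap \<phi> bs css ps = map (\<lambda>i. \<phi> (bs ! i) (css ! i) (ps ! i)) [0..<length bs]"

lemma mk_bio_simps [simp]:
  "Obj (mk_bio C F A) = C" "side s (mk_bio C F A) = F s" "mact s (mk_bio C F A) = A s"
  by (cases s; simp add: mk_bio_def side_def mact_def)+

lemma mk_map_simps [simp]: "obj_map (mk_map f \<phi>) = f" "smap s (mk_map f \<phi>) = \<phi> s"
  by (cases s; simp add: mk_map_def smap_def)+

lemma comp_map_simps [simp]:
  "obj_map (comp_map g h) = obj_map g \<circ> obj_map h"
  "smap s (comp_map g h) c cs p =
    smap s g (obj_map h c) (map (obj_map h) cs) (smap s h c cs p)"
  by (cases s; simp add: comp_map_def smap_def)+

lemma id_map_simps [simp]: "obj_map id_map = (\<lambda>c. c)" "smap s id_map c cs p = p"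
  by (cases s; simp add: id_map_def smap_def)+

text \<open>The two conjuncts of \<open>is_bio\<close> are the values \<open>True\<close> and
  \<open>False\<close> of one statement about \<open>s\<close>, so a proof for an arbitrary sign
  covers both families of axioms.\<close>

lemma is_bio_iff:
  "is_bio B \<longleftrightarrow>
    (\<forall>s. mutual_action (Obj B) (side s B) (side (\<not> s) B) (mact s B) (mact (\<not> s) B))"
  by (simp add: is_bio_def all_bool_eq side_def mact_def conj_commute)

lemma closed_bio_iff:
  "closed_bio B \<longleftrightarrow> is_bio B \<and> (\<forall>b\<in>Obj B. \<forall>s. is_singleton (Ops (side s B) b []))"
  by (auto simp: closed_bio_def all_bool_eq side_def)

lemma is_bio_map_iff:
  "is_bio_map B B' h \<longleftrightarrow> obj_map h ` Obj B \<subseteq> Obj B' \<and>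
    (\<forall>s. operad_map (Obj B) (side s B) (side s B') (obj_map h) (smap s h)) \<and>
    (\<forall>s. preserves_action (side s B) (side (\<not> s) B) (mact s B) (mact s B') (obj_map h)
      (smap s h) (smap (\<not> s) h))"
  by (auto simp: is_bio_map_def all_bool_eq side_def mact_def smap_def)

lemma map_eq_iff:
  "map_eq B g h \<longleftrightarrow> (\<forall>c\<in>Obj B. obj_map g c = obj_map h c) \<and>
    (\<forall>s c cs. \<forall>p\<in>Ops (side s B) c cs. smap s g c cs p = smap s h c cs p)"
  by (auto simp: map_eq_def all_bool_eq side_def smap_def)


section \<open>Families of operations\<close>

lemma length_mmap [simp]: "length (mmap \<phi> bs css ps) = length bs"
  by (simp add: mmap_def)

lemma nth_mmap [simp]: "i < length bs \<Longrightarrow> mmap \<phi> bs css ps ! i = \<phi> (bs ! i) (css ! i) (ps ! i)"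
  by (simp add: mmap_def)

lemma mmap_Nil [simp]: "mmap \<phi> [] css ps = []"
  by (simp add: mmap_def)

lemma mmap_Cons [simp]:
  "mmap \<phi> (b # bs) (cs # css) (p # ps) = \<phi> b cs p # mmap \<phi> bs css ps"
  by (simp add: mmap_def map_upt_Suc del: upt_Suc)

lemma mmap_append:
  assumes "length css = length bs" "length ps = length bs"
  shows "mmap \<phi> (bs @ bs') (css @ css') (ps @ ps') = mmap \<phi> bs css ps @ mmap \<phi> bs' css' ps'"
  using assms by (intro nth_equalityI) (auto simp: nth_append)

lemma multi_ops_iff:
  "ps \<in> multi_ops P bs css \<longleftrightarrow> length css = length bs \<and> length ps = length bs \<and>
    (\<forall>i<length bs. ps ! i \<in> Ops P (bs ! i) (css ! i))"
  by (simp add: multi_ops_def)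

lemma multi_opsD:
  assumes "ps \<in> multi_ops P bs css"
  shows "length css = length bs" "length ps = length bs"
    "\<And>i. i < length bs \<Longrightarrow> ps ! i \<in> Ops P (bs ! i) (css ! i)"
  using assms by (auto simp: multi_ops_def)

lemma multi_multi_opsD:
  assumes "pss \<in> multi_multi_ops P css dsss"
  shows "length dsss = length css" "length pss = length css"
    "\<And>i. i < length css \<Longrightarrow> pss ! i \<in> multi_ops P (css ! i) (dsss ! i)"
  using assms by (auto simp: multi_multi_ops_def)

lemma multi_ops_append:
  assumes "ps \<in> multi_ops P bs css" "ps' \<in> multi_ops P bs' css'"
  shows "ps @ ps' \<in> multi_ops P (bs @ bs') (css @ css')"
  using assms by (auto simp: multi_ops_def nth_append)

lemma multi_multi_ops_Cons:
  "pss \<in> multi_multi_ops P (cs # css) dsss \<longleftrightarrow>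
    (\<exists>ds dsss' ps pss'. dsss = ds # dsss' \<and> pss = ps # pss' \<and>
      ps \<in> multi_ops P cs ds \<and> pss' \<in> multi_multi_ops P css dsss')"
  by (cases dsss; cases pss) (auto simp: multi_multi_ops_def All_less_Suc2)

lemma concat_multi_ops:
  assumes "pss \<in> multi_multi_ops P css dsss"
  shows "concat pss \<in> multi_ops P (concat css) (concat dsss)"
  using assms
proof (induction css arbitrary: dsss pss)
  case Nil
  then show ?case by (simp add: multi_multi_ops_def multi_ops_def)
next
  case (Cons cs css)
  then show ?case by (auto simp: multi_multi_ops_Cons intro!: multi_ops_append)
qed

text \<open>Matching lengths at both levels keep the three concatenations aligned, so that
  \<open>\<phi>\<close> meets each entry together with its own profile.\<close>

lemma mmap_concat:
  assumes "pss \<in> multi_multi_ops P css dsss"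
  shows "mmap \<phi> (concat css) (concat dsss) (concat pss) = concat (mmap (mmap \<phi>) css dsss pss)"
  using assms
proof (induction css arbitrary: dsss pss)
  case (Cons cs css)
  then show ?case by (auto simp: multi_multi_ops_Cons mmap_append multi_opsD)
qed simp

text \<open>The associativity law and the second linearity law act along the words
  \<open>concat (dsss ! i)\<close>, which have to be nonempty for the action to be defined. They
  are, because \<open>dsss ! i\<close> has as many entries as the nonempty word
  \<open>css ! i\<close> and its entries are nonempty.\<close>

lemma multi_multi_ops_nonempty:
  assumes "pss \<in> multi_multi_ops P css dsss" "[] \<notin> set css" "[] \<notin> set (concat dsss)"
  shows "[] \<notin> set (map concat dsss)"
proof
  assume "[] \<in> set (map concat dsss)"
  then obtain i where i: "i < length css" "concat (dsss ! i) = []"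
    using assms(1) by (auto simp: multi_multi_ops_def in_set_conv_nth)
  moreover have "length (dsss ! i) = length (css ! i)"
    using i assms(1) by (simp add: multi_multi_ops_def multi_ops_iff)
  moreover have "css ! i \<noteq> []"
    using i assms(2) by (metis nth_mem)
  ultimately show False
    using assms(3) multi_multi_opsD(1) [OF assms(1)]
    by (metis concat_eq_Nil_conv hd_in_set length_0_conv nth_mem UN_iff set_concat)
qed

section \<open>Permuting families and concatenated words\<close>

lemma permutes_nth_less: "\<sigma> permutes {..<n} \<Longrightarrow> i < n \<Longrightarrow> \<sigma> i < n" for i n :: nat
  using permutes_in_image [of \<sigma> "{..<n}" i] by simp

lemma permute_mmap:
  assumes "\<sigma> permutes {..<length bs}" "length css = length bs" "length ps = length bs"
  shows "permute_list \<sigma> (mmap \<phi> bs css ps) =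
    mmap \<phi> (permute_list \<sigma> bs) (permute_list \<sigma> css) (permute_list \<sigma> ps)"
  using assms by (intro nth_equalityI) (simp_all add: permute_list_nth permutes_nth_less)

lemma permute_multi_ops:
  assumes "\<sigma> permutes {..<length bs}" "ps \<in> multi_ops P bs css"
  shows "permute_list \<sigma> ps \<in> multi_ops P (permute_list \<sigma> bs) (permute_list \<sigma> css)"
  using assms by (simp add: multi_ops_def permute_list_nth permutes_nth_less)

text \<open>The blocks are consecutive intervals starting at 0, so they tile the positions. This
  reduces the permutation property of \<open>block_perm\<close> and of \<open>sum_perm\<close> to an
  equality of multisets.\<close>

lemma concat_blocks: "concat (blocks ms) = [0..<sum_list ms]"
proof -
  have "concat (map (\<lambda>i. [sum_list (take i ms) ..< sum_list (take (Suc i) ms)]) [0..<n]) =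
      [0..<sum_list (take n ms)]" if "n \<le> length ms" for n
    using that
  proof (induction n)
    case (Suc n)
    then have "sum_list (take (Suc n) ms) = sum_list (take n ms) + ms ! n"
      by (simp add: take_Suc_conv_app_nth)
    then show ?case
      using Suc upt_add_eq_append [of 0 "sum_list (take n ms)" "ms ! n"] by simp
  qed simp
  from this [of "length ms"] show ?thesis
    by (simp add: blocks_def)
qed

text \<open>A rearrangement of 0, ..., n-1 is the one-line notation of a permutation; positions from
  \<open>n\<close> on are fixed, as \<open>permutes\<close> demands.\<close>

lemma nth_permutes:
  assumes "mset xs = mset [0..<n]"
  shows "(\<lambda>k. if k < n then xs ! k else k) permutes {..<n}"
proof (rule bij_imp_permutes)
  have len: "length xs = n" and set: "set xs = {..<n}" and dist: "distinct xs"
    using mset_eq_length [OF assms] mset_eq_setD [OF assms] mset_eq_imp_distinct_iff [OF assms]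
    by (simp_all add: atLeast0LessThan)
  show "bij_betw (\<lambda>k. if k < n then xs ! k else k) {..<n} {..<n}"
    by (subst bij_betw_cong [where g = "(!) xs"]) (use bij_betw_nth [OF dist] len set in auto)
qed simp

text \<open>Reordering the blocks does not change the multiset of all positions. The result allows
  the equivariance clause of \<open>operad_map\<close> to be applied to
  \<open>block_perm\<close>.\<close>

lemma block_perm_permutes:
  assumes "\<sigma> permutes {..<length ms}"
  shows "block_perm ms \<sigma> permutes {..<sum_list ms}"
proof -
  have "mset (concat (permute_list \<sigma> (blocks ms))) = mset (concat (blocks ms))"
    using assms by (metis mset_concat mset_map mset_permute_list length_blocks sum_mset_sum_list)
  then show ?thesis
    unfolding block_perm_def by (intro nth_permutes) (simp add: concat_blocks)
qed

lemma length_nth_blocks: "i < length ms \<Longrightarrow> length (blocks ms ! i) = ms ! i"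
  by (simp add: blocks_def take_Suc_conv_app_nth)

text \<open>Each block is shuffled within itself, so the multiset of positions is unchanged block by
  block.\<close>

lemma sum_perm_permutes:
  assumes "length \<tau>s = length ms" "\<And>i. i < length ms \<Longrightarrow> \<tau>s ! i permutes {..<ms ! i}"
  shows "sum_perm ms \<tau>s permutes {..<sum_list ms}"
proof -
  have "map mset (map2 permute_list \<tau>s (blocks ms)) = map mset (blocks ms)"
    using assms by (intro nth_equalityI) (simp_all add: length_nth_blocks)
  then have "mset (concat (map2 permute_list \<tau>s (blocks ms))) = mset (concat (blocks ms))"
    by (simp only: mset_concat)
  then show ?thesis
    unfolding sum_perm_def by (intro nth_permutes) (simp add: concat_blocks)
qed

lemma concat_map_concat: "concat (map concat xss) = concat (concat xss)"
  by (induction xss) auto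


section \<open>Bios with enough maps into bios\<close>

lemma bio_mutual:
  "is_bio B \<Longrightarrow> mutual_action (Obj B) (side s B) (side (\<not> s) B) (mact s B) (mact (\<not> s) B)"
  by (simp add: is_bio_iff)

lemma bio_operad: "is_bio B \<Longrightarrow> is_operad (Obj B) (side s B)"
  using bio_mutual mutual_action.axioms(1) by blast

text \<open>Keeps the typing conditions of a bio and drops every equation: this is the part that a
  candidate has to establish by hand.\<close>

locale pre_bio =
  fixes L :: "('c, 'o) bio"
  assumes ops_colours: "p \<in> Ops (side s L) c cs \<Longrightarrow> c \<in> Obj L \<and> set cs \<subseteq> Obj L"
    and act_mem: "\<lbrakk>p \<in> Ops (side s L) c cs; \<sigma> permutes {..<length cs}\<rbrakk> \<Longrightarrow>
      act (side s L) c cs \<sigma> p \<in> Ops (side s L) c (permute_list \<sigma> cs)"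
    and unit_mem: "c \<in> Obj L \<Longrightarrow> unit_op (side s L) c \<in> Ops (side s L) c [c]"
    and comp_mem: "\<lbrakk>p \<in> Ops (side s L) a bs; ps \<in> multi_ops (side s L) bs css\<rbrakk> \<Longrightarrow>
      comp_op (side s L) a bs css p ps \<in> Ops (side s L) a (concat css)"
    and mact_mem:
      "\<lbrakk>p \<in> Ops (side s L) a (concat css); qs \<in> multi_ops (side (\<not> s) L) bs css; [] \<notin> set css\<rbrakk> \<Longrightarrow>
        mact s L a bs css p qs \<in> Ops (side s L) a bs"
begin

lemma multi_comp_mem:
  assumes "ps \<in> multi_ops (side s L) bs css" "pss \<in> multi_multi_ops (side s L) css dsss"
  shows "map (\<lambda>i. comp_op (side s L) (bs ! i) (css ! i) (dsss ! i) (ps ! i) (pss ! i)) [0..<length bs]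
    \<in> multi_ops (side s L) bs (map concat dsss)"
  using assms by (auto simp: multi_ops_iff multi_multi_ops_def intro!: comp_mem)

lemma multi_mact_mem:
  assumes "ps \<in> multi_ops (side s L) bs (map concat dsss)"
    "qss \<in> multi_multi_ops (side (\<not> s) L) css dsss" "[] \<notin> set (concat dsss)"
  shows "map (\<lambda>i. mact s L (bs ! i) (css ! i) (dsss ! i) (ps ! i) (qss ! i)) [0..<length bs]
    \<in> multi_ops (side s L) bs css"
  using assms by (auto simp: multi_ops_iff [where bs = bs] multi_multi_ops_def intro!: mact_mem)

lemma multi_act_mem:
  assumes "ps \<in> multi_ops (side s L) bs css" "\<tau>s \<in> word_perms css"
  shows "multi_act (side s L) bs css \<tau>s ps \<in> multi_ops (side s L) bs (map2 permute_list \<tau>s css)"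
  using assms by (auto simp: multi_ops_iff word_perms_def multi_act_def intro!: act_mem)

lemma multi_unit_mem:
  assumes "set cs \<subseteq> Obj L"
  shows "map (unit_op (side s L)) cs \<in> multi_ops (side s L) cs (map (\<lambda>c. [c]) cs)"
  using assms by (auto simp: multi_ops_iff intro!: unit_mem)

text \<open>What has to be recognised is the input word of the result: it is the concatenation of
  the permuted words, the form over which the actions are typed.\<close>

lemma block_act_mem:
  assumes "p \<in> Ops (side s L) a (concat css)" "\<sigma> permutes {..<length css}"
  shows "act (side s L) a (concat css) (block_perm (map length css) \<sigma>) p
    \<in> Ops (side s L) a (concat (permute_list \<sigma> css))"
  using act_mem [OF assms(1), of "block_perm (map length css) \<sigma>"]
    block_perm_permutes [of \<sigma> "map length css"] assms(2)
  by (simp add: permute_list_block_perm length_concat)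

lemma sum_act_mem:
  assumes "p \<in> Ops (side s L) a (concat css)" "\<tau>s \<in> word_perms css"
  shows "act (side s L) a (concat css) (sum_perm (map length css) \<tau>s) p
    \<in> Ops (side s L) a (concat (map2 permute_list \<tau>s css))"
  using act_mem [OF assms(1), of "sum_perm (map length css) \<tau>s"]
    sum_perm_permutes [of \<tau>s "map length css"] assms(2)
  by (simp add: permute_list_sum_perm length_concat word_perms_def)

end

lemma is_bio_pre_bio: "is_bio B \<Longrightarrow> pre_bio B"
proof unfold_locales
  fix s
  assume B: "is_bio B"
  interpret mutual_action "Obj B" "side s B" "side (\<not> s) B" "mact s B" "mact (\<not> s) B"
    using B by (rule bio_mutual)
  show "c \<in> Obj B \<and> set cs \<subseteq> Obj B" if "p \<in> Ops (side s B) c cs" for p c cs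
    using that by (rule P.colours)
  show "act (side s B) c cs \<sigma> p \<in> Ops (side s B) c (permute_list \<sigma> cs)"
    if "p \<in> Ops (side s B) c cs" "\<sigma> permutes {..<length cs}" for p c cs \<sigma>
    using that by (rule P.act_closed)
  show "unit_op (side s B) c \<in> Ops (side s B) c [c]" if "c \<in> Obj B" for c
    using that by (rule P.unit_closed)
  show "comp_op (side s B) a bs css p ps \<in> Ops (side s B) a (concat css)"
    if "p \<in> Ops (side s B) a bs" "ps \<in> multi_ops (side s B) bs css" for p a bs ps css
    using that by (rule P.comp_closed)
  show "mact s B a bs css p qs \<in> Ops (side s B) a bs"
    if "p \<in> Ops (side s B) a (concat css)" "qs \<in> multi_ops (side (\<not> s) B) bs css" "[] \<notin> set css"
    for p a css qs bs
    using that by (rule closed)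
qed


section \<open>Maps of bios: preservation rules, identities and composites\<close>

lemma is_bio_mapI:
  assumes "\<And>c. c \<in> Obj B \<Longrightarrow> obj_map h c \<in> Obj B'"
    and "\<And>s c cs p. p \<in> Ops (side s B) c cs \<Longrightarrow>
      smap s h c cs p \<in> Ops (side s B') (obj_map h c) (map (obj_map h) cs)"
    and "\<And>s c cs p \<sigma>. \<lbrakk>p \<in> Ops (side s B) c cs; \<sigma> permutes {..<length cs}\<rbrakk> \<Longrightarrow>
      smap s h c (permute_list \<sigma> cs) (act (side s B) c cs \<sigma> p) =
      act (side s B') (obj_map h c) (map (obj_map h) cs) \<sigma> (smap s h c cs p)"
    and "\<And>s c. c \<in> Obj B \<Longrightarrow>
      smap s h c [c] (unit_op (side s B) c) = unit_op (side s B') (obj_map h c)"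
    and "\<And>s a bs css p ps. \<lbrakk>p \<in> Ops (side s B) a bs; ps \<in> multi_ops (side s B) bs css\<rbrakk> \<Longrightarrow>
      smap s h a (concat css) (comp_op (side s B) a bs css p ps) =
      comp_op (side s B') (obj_map h a) (map (obj_map h) bs) (map (map (obj_map h)) css)
        (smap s h a bs p) (mmap (smap s h) bs css ps)"
    and "\<And>s a bs css p qs. \<lbrakk>p \<in> Ops (side s B) a (concat css);
        qs \<in> multi_ops (side (\<not> s) B) bs css; [] \<notin> set css\<rbrakk> \<Longrightarrow>
      smap s h a bs (mact s B a bs css p qs) =
      mact s B' (obj_map h a) (map (obj_map h) bs) (map (map (obj_map h)) css)
        (smap s h a (concat css) p) (mmap (smap (\<not> s) h) bs css qs)"
  shows "is_bio_map B B' h"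
  unfolding is_bio_map_iff operad_map_def preserves_action_def
  by (intro conjI allI ballI impI image_subsetI; (rule assms [unfolded mmap_def]; assumption))

text \<open>Source and target are arbitrary records, so that maps out of a candidate can be
  exploited before the candidate is known to be a bio.\<close>

locale bio_map =
  fixes B :: "('c, 'o) bio" and B' :: "('d, 'u) bio" and h :: "('c, 'o, 'd, 'u) bio_map"
  assumes is_bio_map: "is_bio_map B B' h"
begin

lemma map_obj: "c \<in> Obj B \<Longrightarrow> obj_map h c \<in> Obj B'"
  using is_bio_map by (auto simp: is_bio_map_iff)

lemma map_op:
  "p \<in> Ops (side s B) c cs \<Longrightarrow> smap s h c cs p \<in> Ops (side s B') (obj_map h c) (map (obj_map h) cs)"
  using is_bio_map by (auto simp: is_bio_map_iff operad_map_def)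

lemma map_act:
  "\<lbrakk>p \<in> Ops (side s B) c cs; \<sigma> permutes {..<length cs}\<rbrakk> \<Longrightarrow>
    smap s h c (permute_list \<sigma> cs) (act (side s B) c cs \<sigma> p) =
    act (side s B') (obj_map h c) (map (obj_map h) cs) \<sigma> (smap s h c cs p)"
  using is_bio_map by (auto simp: is_bio_map_iff operad_map_def)

lemma map_unit:
  "c \<in> Obj B \<Longrightarrow> smap s h c [c] (unit_op (side s B) c) = unit_op (side s B') (obj_map h c)"
  using is_bio_map by (auto simp: is_bio_map_iff operad_map_def)

lemma map_comp:
  "\<lbrakk>p \<in> Ops (side s B) a bs; ps \<in> multi_ops (side s B) bs css\<rbrakk> \<Longrightarrow>
    smap s h a (concat css) (comp_op (side s B) a bs css p ps) =
    comp_op (side s B') (obj_map h a) (map (obj_map h) bs) (map (map (obj_map h)) css)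
      (smap s h a bs p) (mmap (smap s h) bs css ps)"
  using is_bio_map unfolding is_bio_map_iff operad_map_def mmap_def by blast

lemma map_mact:
  "\<lbrakk>p \<in> Ops (side s B) a (concat css); qs \<in> multi_ops (side (\<not> s) B) bs css; [] \<notin> set css\<rbrakk> \<Longrightarrow>
    smap s h a bs (mact s B a bs css p qs) =
    mact s B' (obj_map h a) (map (obj_map h) bs) (map (map (obj_map h)) css)
      (smap s h a (concat css) p) (mmap (smap (\<not> s) h) bs css qs)"
  using is_bio_map unfolding is_bio_map_iff preserves_action_def mmap_def by blast

lemma map_multi_ops:
  "ps \<in> multi_ops (side s B) bs css \<Longrightarrow>
    mmap (smap s h) bs css ps
      \<in> multi_ops (side s B') (map (obj_map h) bs) (map (map (obj_map h)) css)"
  by (auto simp: multi_ops_iff intro!: map_op)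

lemma map_multi_multi_ops:
  "pss \<in> multi_multi_ops (side s B) css dsss \<Longrightarrow>
    mmap (mmap (smap s h)) css dsss pss
      \<in> multi_multi_ops (side s B') (map (map (obj_map h)) css) (map (map (map (obj_map h))) dsss)"
  by (auto simp: multi_multi_ops_def intro!: map_multi_ops)

text \<open>Recolouring leaves the lengths of the words unchanged, so the same permutation of
  positions occurs in source and target.\<close>

lemma map_block_act:
  assumes "p \<in> Ops (side s B) a (concat css)" "\<sigma> permutes {..<length css}"
  shows "smap s h a (concat (permute_list \<sigma> css))
      (act (side s B) a (concat css) (block_perm (map length css) \<sigma>) p) =
    act (side s B') (obj_map h a) (concat (map (map (obj_map h)) css))
      (block_perm (map length (map (map (obj_map h)) css)) \<sigma>) (smap s h a (concat css) p)"
  using map_act [OF assms(1), of "block_perm (map length css) \<sigma>"]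
    block_perm_permutes [of \<sigma> "map length css"] assms(2)
  by (simp add: permute_list_block_perm length_concat map_concat o_def)

lemma map_sum_act:
  assumes "p \<in> Ops (side s B) a (concat css)" "\<tau>s \<in> word_perms css"
  shows "smap s h a (concat (map2 permute_list \<tau>s css))
      (act (side s B) a (concat css) (sum_perm (map length css) \<tau>s) p) =
    act (side s B') (obj_map h a) (concat (map (map (obj_map h)) css))
      (sum_perm (map length (map (map (obj_map h)) css)) \<tau>s) (smap s h a (concat css) p)"
  using map_act [OF assms(1), of "sum_perm (map length css) \<tau>s"]
    sum_perm_permutes [of \<tau>s "map length css"] assms(2)
  by (simp add: permute_list_sum_perm length_concat word_perms_def map_concat o_def)

text \<open>Entries such as \<open>map (obj_map h) bs ! i\<close> are left unevaluated on purpose: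
  the right-hand side is literally the family produced by the axioms of \<open>B'\<close> at the
  image data.\<close>

lemma map_multi_comp:
  assumes "ps \<in> multi_ops (side s B) bs css" "pss \<in> multi_multi_ops (side s B) css dsss"
  shows "mmap (smap s h) bs (map concat dsss)
      (map (\<lambda>i. comp_op (side s B) (bs ! i) (css ! i) (dsss ! i) (ps ! i) (pss ! i)) [0..<length bs]) =
    map (\<lambda>i. comp_op (side s B') (map (obj_map h) bs ! i) (map (map (obj_map h)) css ! i)
        (map (map (map (obj_map h))) dsss ! i) (mmap (smap s h) bs css ps ! i)
        (mmap (mmap (smap s h)) css dsss pss ! i)) [0..<length (map (obj_map h) bs)]"
  using assms by (intro nth_equalityI) (auto simp: multi_ops_iff [of ps] multi_multi_ops_def map_comp)

lemma map_multi_mact: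
  assumes "ps \<in> multi_ops (side s B) bs (map concat dsss)"
    "qss \<in> multi_multi_ops (side (\<not> s) B) css dsss" "[] \<notin> set (concat dsss)"
  shows "mmap (smap s h) bs css
      (map (\<lambda>i. mact s B (bs ! i) (css ! i) (dsss ! i) (ps ! i) (qss ! i)) [0..<length bs]) =
    map (\<lambda>i. mact s B' (map (obj_map h) bs ! i) (map (map (obj_map h)) css ! i)
        (map (map (map (obj_map h))) dsss ! i) (mmap (smap s h) bs (map concat dsss) ps ! i)
        (mmap (mmap (smap (\<not> s) h)) css dsss qss ! i)) [0..<length (map (obj_map h) bs)]"
  using assms by (intro nth_equalityI) (auto simp: multi_ops_iff [of ps] multi_multi_ops_def map_mact)

lemma map_multi_act:
  assumes "ps \<in> multi_ops (side s B) bs css" "\<tau>s \<in> word_perms css"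
  shows "mmap (smap s h) bs (map2 permute_list \<tau>s css) (multi_act (side s B) bs css \<tau>s ps) =
    multi_act (side s B') (map (obj_map h) bs) (map (map (obj_map h)) css) \<tau>s
      (mmap (smap s h) bs css ps)"
  using assms
  by (intro nth_equalityI) (auto simp: multi_ops_iff word_perms_def multi_act_def map_act)

lemma map_multi_unit:
  assumes "set cs \<subseteq> Obj B"
  shows "mmap (smap s h) cs (map (\<lambda>c. [c]) cs) (map (unit_op (side s B)) cs) =
    map (unit_op (side s B')) (map (obj_map h) cs)"
  using assms by (intro nth_equalityI) (auto intro!: map_unit)

end

text \<open>Closure of \<open>B\<close> ensures that the result of every structure map is again a
  point where \<open>g\<close> and \<open>h\<close> agree. The lemma serves composites that are only
  known to agree with a given map on the carriers.\<close>

lemma is_bio_map_cong: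
  assumes B: "is_bio B" and h: "is_bio_map B B' h" and eq: "map_eq B g h"
  shows "is_bio_map B B' g"
proof -
  interpret pre_bio B by (rule is_bio_pre_bio [OF B])
  interpret h: bio_map B B' h by unfold_locales (rule h)
  have obj: "obj_map g c = obj_map h c" if "c \<in> Obj B" for c
    using eq that by (simp add: map_eq_iff)
  have op: "smap s g c cs p = smap s h c cs p" if "p \<in> Ops (side s B) c cs" for s c cs p
    using eq that by (simp add: map_eq_iff)
  have word: "obj_map g c = obj_map h c" "map (obj_map g) cs = map (obj_map h) cs"
    if "p \<in> Ops (side s B) c cs" for s c cs p
    using ops_colours [OF that] obj by (auto simp: subset_iff)
  \<comment> \<open>Families are compared entry by entry: each entry is an operation, so its whole
    profile consists of objects of \<open>B\<close>, where the two maps agree.\<close>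
  have words: "map (obj_map g) bs = map (obj_map h) bs"
      "map (map (obj_map g)) css = map (map (obj_map h)) css"
      "mmap (smap s g) bs css ps = mmap (smap s h) bs css ps"
    if "ps \<in> multi_ops (side s B) bs css" for s bs css ps
  proof -
    note len = multi_opsD(1,2) [OF that] and mem = multi_opsD(3) [OF that]
    show "map (obj_map g) bs = map (obj_map h) bs"
      by (intro nth_equalityI) (simp_all add: word(1) [OF mem])
    show "map (map (obj_map g)) css = map (map (obj_map h)) css"
      by (intro nth_equalityI) (simp_all add: len word(2) [OF mem] del: map_eq_conv)
    show "mmap (smap s g) bs css ps = mmap (smap s h) bs css ps"
      by (intro nth_equalityI) (simp_all add: op [OF mem])
  qed
  show ?thesis
  proof (rule is_bio_mapI)
    show "smap s g c cs p \<in> Ops (side s B') (obj_map g c) (map (obj_map g) cs)"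
      if p: "p \<in> Ops (side s B) c cs" for s c cs p
      using h.map_op [OF p] word [OF p] op [OF p] by (simp del: map_eq_conv)
    show "smap s g c (permute_list \<sigma> cs) (act (side s B) c cs \<sigma> p) =
        act (side s B') (obj_map g c) (map (obj_map g) cs) \<sigma> (smap s g c cs p)"
      if p: "p \<in> Ops (side s B) c cs" and \<sigma>: "\<sigma> permutes {..<length cs}" for s c cs p \<sigma>
      using h.map_act [OF p \<sigma>] word [OF p] op [OF p] op [OF act_mem [OF p \<sigma>]]
      by (simp del: map_eq_conv)
    show "smap s g a (concat css) (comp_op (side s B) a bs css p ps) =
        comp_op (side s B') (obj_map g a) (map (obj_map g) bs) (map (map (obj_map g)) css)
          (smap s g a bs p) (mmap (smap s g) bs css ps)"
      if p: "p \<in> Ops (side s B) a bs" and ps: "ps \<in> multi_ops (side s B) bs css" for s a bs css p ps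
      using h.map_comp [OF p ps] word [OF p] op [OF p] op [OF comp_mem [OF p ps]] words [OF ps]
      by (simp del: map_eq_conv)
    show "smap s g a bs (mact s B a bs css p qs) =
        mact s B' (obj_map g a) (map (obj_map g) bs) (map (map (obj_map g)) css)
          (smap s g a (concat css) p) (mmap (smap (\<not> s) g) bs css qs)"
      if p: "p \<in> Ops (side s B) a (concat css)" and qs: "qs \<in> multi_ops (side (\<not> s) B) bs css"
        and ne: "[] \<notin> set css" for s a bs css p qs
      using h.map_mact [OF p qs ne] word [OF p] op [OF p] op [OF mact_mem [OF p qs ne]] words [OF qs]
      by (simp del: map_eq_conv)
  qed (use obj h.map_obj h.map_unit op [OF unit_mem] in simp_all)
qed

lemma is_bio_map_id: "is_bio_map B B id_map"
proof (rule is_bio_mapI)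
  have mmap: "mmap (smap s id_map) bs css ps = ps" if "ps \<in> multi_ops P bs css"
    for s bs css ps and P :: "('a, 'b) operad"
    using multi_opsD [OF that] by (intro nth_equalityI) simp_all
  show "smap s id_map a (concat css) (comp_op (side s B) a bs css p ps) =
      comp_op (side s B) (obj_map id_map a) (map (obj_map id_map) bs) (map (map (obj_map id_map)) css)
        (smap s id_map a bs p) (mmap (smap s id_map) bs css ps)"
    if "ps \<in> multi_ops (side s B) bs css" for s a bs css p ps
    using that by (simp add: mmap)
  show "smap s id_map a bs (mact s B a bs css p qs) =
      mact s B (obj_map id_map a) (map (obj_map id_map) bs) (map (map (obj_map id_map)) css)
        (smap s id_map a (concat css) p) (mmap (smap (\<not> s) id_map) bs css qs)"
    if "qs \<in> multi_ops (side (\<not> s) B) bs css" for s a bs css p qs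
    using that by (simp add: mmap)
qed simp_all

lemma is_bio_map_comp:
  assumes g: "is_bio_map B' B'' g" and h: "is_bio_map B B' h"
  shows "is_bio_map B B'' (comp_map g h)"
proof -
  interpret g: bio_map B' B'' g by unfold_locales (rule g)
  interpret h: bio_map B B' h by unfold_locales (rule h)
  have mmap: "mmap (smap s (comp_map g h)) bs css ps =
      mmap (smap s g) (map (obj_map h) bs) (map (map (obj_map h)) css) (mmap (smap s h) bs css ps)"
    if "ps \<in> multi_ops (side s B) bs css" for s bs css ps
    using multi_opsD [OF that] by (intro nth_equalityI) simp_all
  show ?thesis
  proof (rule is_bio_mapI)
    show "obj_map (comp_map g h) c \<in> Obj B''" if "c \<in> Obj B" for c
      using g.map_obj [OF h.map_obj [OF that]] by simp
    show "smap s (comp_map g h) c cs p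
        \<in> Ops (side s B'') (obj_map (comp_map g h) c) (map (obj_map (comp_map g h)) cs)"
      if "p \<in> Ops (side s B) c cs" for s c cs p
      using g.map_op [OF h.map_op [OF that]] by simp
    show "smap s (comp_map g h) c (permute_list \<sigma> cs) (act (side s B) c cs \<sigma> p) =
        act (side s B'') (obj_map (comp_map g h) c) (map (obj_map (comp_map g h)) cs) \<sigma>
          (smap s (comp_map g h) c cs p)"
      if "p \<in> Ops (side s B) c cs" "\<sigma> permutes {..<length cs}" for s c cs p \<sigma>
      using g.map_act [OF h.map_op [OF that(1)], of \<sigma>] h.map_act [OF that] that(2)
      by (simp add: permute_list_map)
    show "smap s (comp_map g h) c [c] (unit_op (side s B) c) =
        unit_op (side s B'') (obj_map (comp_map g h) c)" if "c \<in> Obj B" for s c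
      using g.map_unit [OF h.map_obj [OF that]] h.map_unit [OF that] by simp
    show "smap s (comp_map g h) a (concat css) (comp_op (side s B) a bs css p ps) =
        comp_op (side s B'') (obj_map (comp_map g h) a) (map (obj_map (comp_map g h)) bs)
          (map (map (obj_map (comp_map g h))) css) (smap s (comp_map g h) a bs p)
          (mmap (smap s (comp_map g h)) bs css ps)"
      if p: "p \<in> Ops (side s B) a bs" and ps: "ps \<in> multi_ops (side s B) bs css" for s a bs css p ps
      using g.map_comp [OF h.map_op [OF p] h.map_multi_ops [OF ps]] h.map_comp [OF p ps]
      by (simp add: mmap [OF ps] map_concat)
    show "smap s (comp_map g h) a bs (mact s B a bs css p qs) =
        mact s B'' (obj_map (comp_map g h) a) (map (obj_map (comp_map g h)) bs)
          (map (map (obj_map (comp_map g h))) css) (smap s (comp_map g h) a (concat css) p)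
          (mmap (smap (\<not> s) (comp_map g h)) bs css qs)"
      if p: "p \<in> Ops (side s B) a (concat css)" and qs: "qs \<in> multi_ops (side (\<not> s) B) bs css"
        and ne: "[] \<notin> set css" for s a bs css p qs
    proof -
      have p': "smap s h a (concat css) p
          \<in> Ops (side s B') (obj_map h a) (concat (map (map (obj_map h)) css))"
        and ne': "[] \<notin> set (map (map (obj_map h)) css)"
        using h.map_op [OF p] ne by (auto simp: map_concat)
      show ?thesis
        using g.map_mact [OF p' h.map_multi_ops [OF qs] ne'] h.map_mact [OF p qs ne]
        by (simp add: mmap [OF qs] map_concat)
    qed
  qed
qed

section \<open>Reflection of the axioms along a jointly faithful family\<close>

lemma word_perms_map [simp]: "word_perms (map (map f) css) = word_perms css"
  by (auto simp: word_perms_def)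

lemma map2_permute_list_map:
  assumes "\<tau>s \<in> word_perms css"
  shows "map (map f) (map2 permute_list \<tau>s css) = map2 permute_list \<tau>s (map (map f) css)"
  using assms by (intro nth_equalityI) (auto simp: word_perms_def permute_list_map)

text \<open>Separation is asked only of parallel operations, those with the same profile. This fits
  the axioms, whose two sides always have the same profile.\<close>

locale jointly_faithful = pre_bio L for L :: "('c, 'o) bio" +
  fixes I :: "'k set" and X :: "'k \<Rightarrow> ('d, 'u) bio" and \<pi> :: "'k \<Rightarrow> ('c, 'o, 'd, 'u) bio_map"
  assumes bio: "k \<in> I \<Longrightarrow> is_bio (X k)"
    and proj: "k \<in> I \<Longrightarrow> is_bio_map L (X k) (\<pi> k)"
    and faithful: "\<lbrakk>p \<in> Ops (side s L) c cs; q \<in> Ops (side s L) c cs;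
      \<And>k. k \<in> I \<Longrightarrow> smap s (\<pi> k) c cs p = smap s (\<pi> k) c cs q\<rbrakk> \<Longrightarrow> p = q"
begin

text \<open>Closure puts both sides of an equation into one set \<open>Ops\<close>, and each
  \<open>\<pi> k\<close> sends them to the two sides of the same equation in \<open>X k\<close>,
  where it holds. The cases differ only in how \<open>\<pi> k\<close> is pushed through the nested
  expressions.\<close>

lemma operad: "is_operad (Obj L) (side s L)"
proof
  let ?P = "side s L"
  show "c \<in> Obj L \<and> set cs \<subseteq> Obj L" if "p \<in> Ops ?P c cs" for p c cs
    using that by (rule ops_colours)
  show "act ?P c cs \<sigma> p \<in> Ops ?P c (permute_list \<sigma> cs)"
    if "p \<in> Ops ?P c cs" "\<sigma> permutes {..<length cs}" for p c cs \<sigma>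
    using that by (rule act_mem)
  show "unit_op ?P c \<in> Ops ?P c [c]" if "c \<in> Obj L" for c
    using that by (rule unit_mem)
  show "comp_op ?P a bs css p ps \<in> Ops ?P a (concat css)"
    if "p \<in> Ops ?P a bs" "ps \<in> multi_ops ?P bs css" for p a bs ps css
    using that by (rule comp_mem)
  show "act ?P c cs id p = p" if p: "p \<in> Ops ?P c cs" for p c cs
  proof (rule faithful)
    show "act ?P c cs id p \<in> Ops ?P c cs"
      using act_mem [OF p permutes_id] by simp
    fix k assume k: "k \<in> I"
    interpret X: is_operad "Obj (X k)" "side s (X k)" by (rule bio_operad [OF bio [OF k]])
    interpret bio_map L "X k" "\<pi> k" by unfold_locales (rule proj [OF k])
    show "smap s (\<pi> k) c cs (act ?P c cs id p) = smap s (\<pi> k) c cs p"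
      using map_act [OF p permutes_id] X.act_id [OF map_op [OF p]] by simp
  qed (rule p)
  show "act ?P c (permute_list \<sigma> cs) \<tau> (act ?P c cs \<sigma> p) = act ?P c cs (\<sigma> \<circ> \<tau>) p"
    if p: "p \<in> Ops ?P c cs" and \<sigma>: "\<sigma> permutes {..<length cs}" and \<tau>: "\<tau> permutes {..<length cs}"
    for p c cs \<sigma> \<tau>
  proof (rule faithful)
    have \<sigma>\<tau>: "\<sigma> \<circ> \<tau> permutes {..<length cs}" and \<tau>': "\<tau> permutes {..<length (permute_list \<sigma> cs)}"
      using permutes_compose [OF \<tau> \<sigma>] \<tau> by simp_all
    \<comment> \<open>The two sides carry differently written words; this identifies them, since
      \<open>faithful\<close> compares operations over one word.\<close>
    have eq: "permute_list \<tau> (permute_list \<sigma> cs) = permute_list (\<sigma> \<circ> \<tau>) cs"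
      using permute_list_compose [OF \<tau>] by simp
    show "act ?P c (permute_list \<sigma> cs) \<tau> (act ?P c cs \<sigma> p) \<in> Ops ?P c (permute_list (\<sigma> \<circ> \<tau>) cs)"
      using act_mem [OF act_mem [OF p \<sigma>] \<tau>'] eq by simp
    show "act ?P c cs (\<sigma> \<circ> \<tau>) p \<in> Ops ?P c (permute_list (\<sigma> \<circ> \<tau>) cs)"
      by (rule act_mem [OF p \<sigma>\<tau>])
    fix k assume k: "k \<in> I"
    interpret X: is_operad "Obj (X k)" "side s (X k)" by (rule bio_operad [OF bio [OF k]])
    interpret bio_map L "X k" "\<pi> k" by unfold_locales (rule proj [OF k])
    show "smap s (\<pi> k) c (permute_list (\<sigma> \<circ> \<tau>) cs) (act ?P c (permute_list \<sigma> cs) \<tau> (act ?P c cs \<sigma> p)) =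
        smap s (\<pi> k) c (permute_list (\<sigma> \<circ> \<tau>) cs) (act ?P c cs (\<sigma> \<circ> \<tau>) p)"
      using map_act [OF p \<sigma>\<tau>] map_act [OF act_mem [OF p \<sigma>] \<tau>'] map_act [OF p \<sigma>] \<sigma> \<tau>
        X.act_act [OF map_op [OF p]] eq by (simp add: permute_list_map [symmetric])
  qed
  show "comp_op ?P c [c] [cs] (unit_op ?P c) [p] = p" if p: "p \<in> Ops ?P c cs" for p c cs
  proof (rule faithful)
    have c: "c \<in> Obj L"
      using ops_colours [OF p] by simp
    have ps: "[p] \<in> multi_ops ?P [c] [cs]"
      using p by (simp add: multi_ops_iff)
    show "comp_op ?P c [c] [cs] (unit_op ?P c) [p] \<in> Ops ?P c cs"
      using comp_mem [OF unit_mem [OF c] ps] by simp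
    fix k assume k: "k \<in> I"
    interpret X: is_operad "Obj (X k)" "side s (X k)" by (rule bio_operad [OF bio [OF k]])
    interpret bio_map L "X k" "\<pi> k" by unfold_locales (rule proj [OF k])
    show "smap s (\<pi> k) c cs (comp_op ?P c [c] [cs] (unit_op ?P c) [p]) = smap s (\<pi> k) c cs p"
      using map_comp [OF unit_mem [OF c] ps] X.comp_unit_left [OF map_op [OF p]] map_unit [OF c]
      by simp
  qed (rule p)
  show "comp_op ?P c cs (map (\<lambda>c. [c]) cs) p (map (unit_op ?P) cs) = p"
    if p: "p \<in> Ops ?P c cs" for p c cs
  proof (rule faithful)
    have cs: "set cs \<subseteq> Obj L"
      using ops_colours [OF p] by simp
    note ps = multi_unit_mem [OF cs, of s]
    show "comp_op ?P c cs (map (\<lambda>c. [c]) cs) p (map (unit_op ?P) cs) \<in> Ops ?P c cs"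
      using comp_mem [OF p ps] by simp
    fix k assume k: "k \<in> I"
    interpret X: is_operad "Obj (X k)" "side s (X k)" by (rule bio_operad [OF bio [OF k]])
    interpret bio_map L "X k" "\<pi> k" by unfold_locales (rule proj [OF k])
    show "smap s (\<pi> k) c cs (comp_op ?P c cs (map (\<lambda>c. [c]) cs) p (map (unit_op ?P) cs)) =
        smap s (\<pi> k) c cs p"
      using map_comp [OF p ps] X.comp_unit_right [OF map_op [OF p]] map_multi_unit [OF cs]
      by (simp add: o_def)
  qed (rule p)
  show "comp_op ?P a (concat css) (concat dsss) (comp_op ?P a bs css p ps) (concat pss) =
      comp_op ?P a bs (map concat dsss) p
        (map (\<lambda>i. comp_op ?P (bs ! i) (css ! i) (dsss ! i) (ps ! i) (pss ! i)) [0..<length bs])"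
    if p: "p \<in> Ops ?P a bs" and ps: "ps \<in> multi_ops ?P bs css"
      and pss: "pss \<in> multi_multi_ops ?P css dsss" for p a bs ps css pss dsss
  proof (rule faithful)
    note pp = comp_mem [OF p ps] and pps = multi_comp_mem [OF ps pss] and cps = concat_multi_ops [OF pss]
    show "comp_op ?P a (concat css) (concat dsss) (comp_op ?P a bs css p ps) (concat pss)
        \<in> Ops ?P a (concat (concat dsss))"
      by (rule comp_mem [OF pp cps])
    show "comp_op ?P a bs (map concat dsss) p
        (map (\<lambda>i. comp_op ?P (bs ! i) (css ! i) (dsss ! i) (ps ! i) (pss ! i)) [0..<length bs])
        \<in> Ops ?P a (concat (concat dsss))"
      using comp_mem [OF p pps] by (simp add: concat_map_concat)
    fix k assume k: "k \<in> I"
    interpret X: is_operad "Obj (X k)" "side s (X k)" by (rule bio_operad [OF bio [OF k]])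
    interpret bio_map L "X k" "\<pi> k" by unfold_locales (rule proj [OF k])
    show "smap s (\<pi> k) a (concat (concat dsss))
        (comp_op ?P a (concat css) (concat dsss) (comp_op ?P a bs css p ps) (concat pss)) =
      smap s (\<pi> k) a (concat (concat dsss)) (comp_op ?P a bs (map concat dsss) p
        (map (\<lambda>i. comp_op ?P (bs ! i) (css ! i) (dsss ! i) (ps ! i) (pss ! i)) [0..<length bs]))"
      using X.comp_assoc [OF map_op [OF p] map_multi_ops [OF ps] map_multi_multi_ops [OF pss]]
        map_comp [OF p pps] map_multi_comp [OF ps pss]
      unfolding map_comp [OF pp cps] map_comp [OF p ps] mmap_concat [OF pss]
      \<comment> \<open>Evaluating entries of mapped lists would destroy the match between the
        family in the axiom of \<open>X k\<close> and the one given by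
        \<open>map_multi_comp\<close>.\<close>
      by (simp add: map_concat o_def concat_map_concat del: nth_map nth_mmap)
  qed
  show "comp_op ?P a (permute_list \<sigma> bs) (permute_list \<sigma> css) (act ?P a bs \<sigma> p) (permute_list \<sigma> ps) =
      act ?P a (concat css) (block_perm (map length css) \<sigma>) (comp_op ?P a bs css p ps)"
    if p: "p \<in> Ops ?P a bs" and ps: "ps \<in> multi_ops ?P bs css" and \<sigma>: "\<sigma> permutes {..<length bs}"
    for p a bs ps css \<sigma>
  proof (rule faithful)
    have \<sigma>': "\<sigma> permutes {..<length css}"
      using \<sigma> ps by (simp add: multi_opsD)
    note pp = act_mem [OF p \<sigma>] and pps = permute_multi_ops [OF \<sigma> ps]
    show "comp_op ?P a (permute_list \<sigma> bs) (permute_list \<sigma> css) (act ?P a bs \<sigma> p) (permute_list \<sigma> ps)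
        \<in> Ops ?P a (concat (permute_list \<sigma> css))"
      by (rule comp_mem [OF pp pps])
    show "act ?P a (concat css) (block_perm (map length css) \<sigma>) (comp_op ?P a bs css p ps)
        \<in> Ops ?P a (concat (permute_list \<sigma> css))"
      by (rule block_act_mem [OF comp_mem [OF p ps] \<sigma>'])
    fix k assume k: "k \<in> I"
    interpret X: is_operad "Obj (X k)" "side s (X k)" by (rule bio_operad [OF bio [OF k]])
    interpret bio_map L "X k" "\<pi> k" by unfold_locales (rule proj [OF k])
    show "smap s (\<pi> k) a (concat (permute_list \<sigma> css)) (comp_op ?P a (permute_list \<sigma> bs)
          (permute_list \<sigma> css) (act ?P a bs \<sigma> p) (permute_list \<sigma> ps)) =
        smap s (\<pi> k) a (concat (permute_list \<sigma> css))
          (act ?P a (concat css) (block_perm (map length css) \<sigma>) (comp_op ?P a bs css p ps))"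
      using X.comp_act_outer [OF map_op [OF p] map_multi_ops [OF ps], of \<sigma>] \<sigma> \<sigma>' ps
      unfolding map_block_act [OF comp_mem [OF p ps] \<sigma>'] map_comp [OF p ps] map_comp [OF pp pps]
        map_act [OF p \<sigma>]
      by (simp add: permute_mmap permute_list_map multi_opsD)
  qed
  show "comp_op ?P a bs (map2 permute_list \<tau>s css) p (multi_act ?P bs css \<tau>s ps) =
      act ?P a (concat css) (sum_perm (map length css) \<tau>s) (comp_op ?P a bs css p ps)"
    if p: "p \<in> Ops ?P a bs" and ps: "ps \<in> multi_ops ?P bs css" and \<tau>s: "\<tau>s \<in> word_perms css"
    for p a bs ps css \<tau>s
  proof (rule faithful)
    note pps = multi_act_mem [OF ps \<tau>s]
    show "comp_op ?P a bs (map2 permute_list \<tau>s css) p (multi_act ?P bs css \<tau>s ps)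
        \<in> Ops ?P a (concat (map2 permute_list \<tau>s css))"
      by (rule comp_mem [OF p pps])
    show "act ?P a (concat css) (sum_perm (map length css) \<tau>s) (comp_op ?P a bs css p ps)
        \<in> Ops ?P a (concat (map2 permute_list \<tau>s css))"
      by (rule sum_act_mem [OF comp_mem [OF p ps] \<tau>s])
    fix k assume k: "k \<in> I"
    interpret X: is_operad "Obj (X k)" "side s (X k)" by (rule bio_operad [OF bio [OF k]])
    interpret bio_map L "X k" "\<pi> k" by unfold_locales (rule proj [OF k])
    show "smap s (\<pi> k) a (concat (map2 permute_list \<tau>s css))
          (comp_op ?P a bs (map2 permute_list \<tau>s css) p (multi_act ?P bs css \<tau>s ps)) =
        smap s (\<pi> k) a (concat (map2 permute_list \<tau>s css))
          (act ?P a (concat css) (sum_perm (map length css) \<tau>s) (comp_op ?P a bs css p ps))"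
      using X.comp_act_inner [OF map_op [OF p] map_multi_ops [OF ps], of \<tau>s] \<tau>s
      unfolding map_sum_act [OF comp_mem [OF p ps] \<tau>s] map_comp [OF p ps] map_comp [OF p pps]
        map_multi_act [OF ps \<tau>s] map2_permute_list_map [OF \<tau>s]
      by simp
  qed
qed

text \<open>The argument is the same cancellation of the \<open>\<pi> k\<close>. As \<open>s\<close>
  is arbitrary, exchanging \<open>s\<close> and \<open>\<not> s\<close> yields the other half of the
  axioms.\<close>

lemma mutual: "mutual_action (Obj L) (side s L) (side (\<not> s) L) (mact s L) (mact (\<not> s) L)"
proof (intro mutual_action.intro operad mutual_action_axioms.intro)
  let ?P = "side s L" and ?Q = "side (\<not> s) L" and ?\<alpha> = "mact s L" and ?\<beta> = "mact (\<not> s) L"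
  show "?\<alpha> a bs css p qs \<in> Ops ?P a bs"
    if "p \<in> Ops ?P a (concat css)" "qs \<in> multi_ops ?Q bs css" "[] \<notin> set css" for p a css qs bs
    using that by (rule mact_mem)
  show "?\<alpha> a (permute_list \<sigma> bs) (permute_list \<sigma> css)
        (act ?P a (concat css) (block_perm (map length css) \<sigma>) p) (permute_list \<sigma> qs) =
      act ?P a bs \<sigma> (?\<alpha> a bs css p qs)"
    if p: "p \<in> Ops ?P a (concat css)" and qs: "qs \<in> multi_ops ?Q bs css" and ne: "[] \<notin> set css"
      and \<sigma>: "\<sigma> permutes {..<length bs}" for p a css qs bs \<sigma>
  proof (rule faithful)
    have \<sigma>': "\<sigma> permutes {..<length css}"
      using \<sigma> qs by (simp add: multi_opsD)
    have ne': "[] \<notin> set (permute_list \<sigma> css)"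
      using ne \<sigma>' by simp
    note pp = block_act_mem [OF p \<sigma>'] and qqs = permute_multi_ops [OF \<sigma> qs]
    show "?\<alpha> a (permute_list \<sigma> bs) (permute_list \<sigma> css)
        (act ?P a (concat css) (block_perm (map length css) \<sigma>) p) (permute_list \<sigma> qs)
        \<in> Ops ?P a (permute_list \<sigma> bs)"
      by (rule mact_mem [OF pp qqs ne'])
    show "act ?P a bs \<sigma> (?\<alpha> a bs css p qs) \<in> Ops ?P a (permute_list \<sigma> bs)"
      by (rule act_mem [OF mact_mem [OF p qs ne] \<sigma>])
    fix k assume k: "k \<in> I"
    interpret X: mutual_action "Obj (X k)" "side s (X k)" "side (\<not> s) (X k)"
        "mact s (X k)" "mact (\<not> s) (X k)"
      by (rule bio_mutual [OF bio [OF k]])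
    interpret bio_map L "X k" "\<pi> k" by unfold_locales (rule proj [OF k])
    show "smap s (\<pi> k) a (permute_list \<sigma> bs) (?\<alpha> a (permute_list \<sigma> bs) (permute_list \<sigma> css)
          (act ?P a (concat css) (block_perm (map length css) \<sigma>) p) (permute_list \<sigma> qs)) =
        smap s (\<pi> k) a (permute_list \<sigma> bs) (act ?P a bs \<sigma> (?\<alpha> a bs css p qs))"
      \<comment> \<open>The membership premise is left open: its word is a concatenation of
        recoloured words, which agrees with the recoloured concatenation only after
        \<open>map_concat\<close>.\<close>
      using X.covariant [OF _ map_multi_ops [OF qs], of "smap s (\<pi> k) a (concat css) p" _ \<sigma>]
        map_op [OF p] \<sigma> \<sigma>' ne qs
      unfolding map_mact [OF pp qqs ne'] map_act [OF mact_mem [OF p qs ne] \<sigma>] map_mact [OF p qs ne]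
        map_block_act [OF p \<sigma>']
      by (auto simp: permute_mmap permute_list_map multi_opsD map_concat)
  qed
  show "?\<alpha> a bs (map2 permute_list \<tau>s css)
        (act ?P a (concat css) (sum_perm (map length css) \<tau>s) p) (multi_act ?Q bs css \<tau>s qs) =
      ?\<alpha> a bs css p qs"
    if p: "p \<in> Ops ?P a (concat css)" and qs: "qs \<in> multi_ops ?Q bs css" and ne: "[] \<notin> set css"
      and \<tau>s: "\<tau>s \<in> word_perms css" for p a css qs bs \<tau>s
  proof (rule faithful)
    \<comment> \<open>Permuting inside a word preserves its length, hence nonemptiness.\<close>
    have ne': "[] \<notin> set (map2 permute_list \<tau>s css)"
      using ne by (auto dest!: set_zip_rightD) (metis length_permute_list length_0_conv)
    note pp = sum_act_mem [OF p \<tau>s] and qqs = multi_act_mem [OF qs \<tau>s]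
    show "?\<alpha> a bs (map2 permute_list \<tau>s css)
        (act ?P a (concat css) (sum_perm (map length css) \<tau>s) p) (multi_act ?Q bs css \<tau>s qs)
        \<in> Ops ?P a bs"
      by (rule mact_mem [OF pp qqs ne'])
    show "?\<alpha> a bs css p qs \<in> Ops ?P a bs"
      by (rule mact_mem [OF p qs ne])
    fix k assume k: "k \<in> I"
    interpret X: mutual_action "Obj (X k)" "side s (X k)" "side (\<not> s) (X k)"
        "mact s (X k)" "mact (\<not> s) (X k)"
      by (rule bio_mutual [OF bio [OF k]])
    interpret bio_map L "X k" "\<pi> k" by unfold_locales (rule proj [OF k])
    show "smap s (\<pi> k) a bs (?\<alpha> a bs (map2 permute_list \<tau>s css)
          (act ?P a (concat css) (sum_perm (map length css) \<tau>s) p) (multi_act ?Q bs css \<tau>s qs)) =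
        smap s (\<pi> k) a bs (?\<alpha> a bs css p qs)"
      using X.invariant [OF _ map_multi_ops [OF qs], of "smap s (\<pi> k) a (concat css) p" _ \<tau>s]
        map_op [OF p] \<tau>s ne
      unfolding map_mact [OF pp qqs ne'] map_mact [OF p qs ne] map_sum_act [OF p \<tau>s]
        map_multi_act [OF qs \<tau>s] map2_permute_list_map [OF \<tau>s]
      by (auto simp: map_concat)
  qed
  show "?\<alpha> c cs (map (\<lambda>c. [c]) cs) p (map (unit_op ?Q) cs) = p" if p: "p \<in> Ops ?P c cs" for p c cs
  proof (rule faithful)
    have cs: "set cs \<subseteq> Obj L"
      using ops_colours [OF p] by simp
    have p': "p \<in> Ops ?P c (concat (map (\<lambda>c. [c]) cs))" and ne: "[] \<notin> set (map (\<lambda>c. [c]) cs)"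
      using p by auto
    note qs = multi_unit_mem [OF cs, of "\<not> s"]
    show "?\<alpha> c cs (map (\<lambda>c. [c]) cs) p (map (unit_op ?Q) cs) \<in> Ops ?P c cs"
      by (rule mact_mem [OF p' qs ne])
    fix k assume k: "k \<in> I"
    interpret X: mutual_action "Obj (X k)" "side s (X k)" "side (\<not> s) (X k)"
        "mact s (X k)" "mact (\<not> s) (X k)"
      by (rule bio_mutual [OF bio [OF k]])
    interpret bio_map L "X k" "\<pi> k" by unfold_locales (rule proj [OF k])
    show "smap s (\<pi> k) c cs (?\<alpha> c cs (map (\<lambda>c. [c]) cs) p (map (unit_op ?Q) cs)) =
        smap s (\<pi> k) c cs p"
      using map_mact [OF p' qs ne] X.unital [OF map_op [OF p]] map_multi_unit [OF cs]
      by (simp add: o_def)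
  qed (rule p)
  show "?\<alpha> a bs css (?\<alpha> a (concat css) (concat dsss) p (concat qss)) qs =
      ?\<alpha> a bs (map concat dsss) p
        (map (\<lambda>i. comp_op ?Q (bs ! i) (css ! i) (dsss ! i) (qs ! i) (qss ! i)) [0..<length bs])"
    if p: "p \<in> Ops ?P a (concat (concat dsss))" and qs: "qs \<in> multi_ops ?Q bs css"
      and qss: "qss \<in> multi_multi_ops ?Q css dsss"
      and ne: "[] \<notin> set css" and ne': "[] \<notin> set (concat dsss)" for p a dsss qs bs css qss
  proof (rule faithful)
    have p': "p \<in> Ops ?P a (concat (map concat dsss))"
      using p by (simp add: concat_map_concat)
    have ne'': "[] \<notin> set (map concat dsss)"
      by (rule multi_multi_ops_nonempty [OF qss ne ne'])
    note qqs = multi_comp_mem [OF qs qss] and cqs = concat_multi_ops [OF qss]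
    note pp = mact_mem [OF p cqs ne']
    show "?\<alpha> a bs css (?\<alpha> a (concat css) (concat dsss) p (concat qss)) qs \<in> Ops ?P a bs"
      by (rule mact_mem [OF pp qs ne])
    show "?\<alpha> a bs (map concat dsss) p
        (map (\<lambda>i. comp_op ?Q (bs ! i) (css ! i) (dsss ! i) (qs ! i) (qss ! i)) [0..<length bs])
        \<in> Ops ?P a bs"
      by (rule mact_mem [OF p' qqs ne''])
    fix k assume k: "k \<in> I"
    interpret X: mutual_action "Obj (X k)" "side s (X k)" "side (\<not> s) (X k)"
        "mact s (X k)" "mact (\<not> s) (X k)"
      by (rule bio_mutual [OF bio [OF k]])
    interpret bio_map L "X k" "\<pi> k" by unfold_locales (rule proj [OF k])
    show "smap s (\<pi> k) a bs (?\<alpha> a bs css (?\<alpha> a (concat css) (concat dsss) p (concat qss)) qs) =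
        smap s (\<pi> k) a bs (?\<alpha> a bs (map concat dsss) p
          (map (\<lambda>i. comp_op ?Q (bs ! i) (css ! i) (dsss ! i) (qs ! i) (qss ! i)) [0..<length bs]))"
      using X.assoc [OF _ map_multi_ops [OF qs] map_multi_multi_ops [OF qss],
          of "smap s (\<pi> k) a (concat (concat dsss)) p"] map_op [OF p] ne ne'
      unfolding map_mact [OF pp qs ne] map_mact [OF p cqs ne'] map_mact [OF p' qqs ne'']
        map_multi_comp [OF qs qss] mmap_concat [OF qss]
      by (auto simp: map_concat o_def concat_map_concat simp del: nth_map nth_mmap)
  qed
  show "?\<alpha> a (concat css) (concat dsss) (comp_op ?P a bs (map concat dsss) p ps) (concat qss) =
      comp_op ?P a bs css p
        (map (\<lambda>i. ?\<alpha> (bs ! i) (css ! i) (dsss ! i) (ps ! i) (qss ! i)) [0..<length bs])"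
    if p: "p \<in> Ops ?P a bs" and ps: "ps \<in> multi_ops ?P bs (map concat dsss)"
      and qss: "qss \<in> multi_multi_ops ?Q css dsss" and ne: "[] \<notin> set (concat dsss)"
    for p a bs ps dsss qss css
  proof (rule faithful)
    have pp: "comp_op ?P a bs (map concat dsss) p ps \<in> Ops ?P a (concat (concat dsss))"
      using comp_mem [OF p ps] by (simp add: concat_map_concat)
    note pps = multi_mact_mem [OF ps qss ne] and cqs = concat_multi_ops [OF qss]
    show "?\<alpha> a (concat css) (concat dsss) (comp_op ?P a bs (map concat dsss) p ps) (concat qss)
        \<in> Ops ?P a (concat css)"
      by (rule mact_mem [OF pp cqs ne])
    show "comp_op ?P a bs css p
        (map (\<lambda>i. ?\<alpha> (bs ! i) (css ! i) (dsss ! i) (ps ! i) (qss ! i)) [0..<length bs])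
        \<in> Ops ?P a (concat css)"
      by (rule comp_mem [OF p pps])
    fix k assume k: "k \<in> I"
    interpret X: mutual_action "Obj (X k)" "side s (X k)" "side (\<not> s) (X k)"
        "mact s (X k)" "mact (\<not> s) (X k)"
      by (rule bio_mutual [OF bio [OF k]])
    interpret bio_map L "X k" "\<pi> k" by unfold_locales (rule proj [OF k])
    show "smap s (\<pi> k) a (concat css)
          (?\<alpha> a (concat css) (concat dsss) (comp_op ?P a bs (map concat dsss) p ps) (concat qss)) =
        smap s (\<pi> k) a (concat css) (comp_op ?P a bs css p
          (map (\<lambda>i. ?\<alpha> (bs ! i) (css ! i) (dsss ! i) (ps ! i) (qss ! i)) [0..<length bs]))"
      using X.linear_comp [OF map_op [OF p] _ map_multi_multi_ops [OF qss],
          of "mmap (smap s (\<pi> k)) bs (map concat dsss) ps"] map_multi_ops [OF ps] ne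
        map_comp [OF p ps]
      unfolding map_mact [OF pp cqs ne] map_comp [OF p pps]
        map_multi_mact [OF ps qss ne] mmap_concat [OF qss]
      by (auto simp: map_concat o_def concat_map_concat simp del: nth_map nth_mmap)
  qed
  show "?\<alpha> a bs css p
        (map (\<lambda>i. ?\<beta> (bs ! i) (css ! i) (dsss ! i) (qs ! i) (pss ! i)) [0..<length bs]) =
      ?\<alpha> a bs (map concat dsss) (comp_op ?P a (concat css) (concat dsss) p (concat pss)) qs"
    if p: "p \<in> Ops ?P a (concat css)" and qs: "qs \<in> multi_ops ?Q bs (map concat dsss)"
      and pss: "pss \<in> multi_multi_ops ?P css dsss"
      and ne: "[] \<notin> set css" and ne': "[] \<notin> set (concat dsss)" for p a css qs bs dsss pss
  proof (rule faithful)
    \<comment> \<open>The inner action \<open>?\<beta>\<close> is \<open>mact (\<not> s)\<close>,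
      whose acting family is typed in \<open>side (\<not> \<not> s)\<close>.\<close>
    have pss': "pss \<in> multi_multi_ops (side (\<not> \<not> s) L) css dsss"
      using pss by simp
    have ne'': "[] \<notin> set (map concat dsss)"
      by (rule multi_multi_ops_nonempty [OF pss ne ne'])
    note qqs = multi_mact_mem [OF qs pss' ne'] and cps = concat_multi_ops [OF pss]
    have pp: "comp_op ?P a (concat css) (concat dsss) p (concat pss) \<in> Ops ?P a (concat (map concat dsss))"
      using comp_mem [OF p cps] by (simp add: concat_map_concat)
    show "?\<alpha> a bs css p
        (map (\<lambda>i. ?\<beta> (bs ! i) (css ! i) (dsss ! i) (qs ! i) (pss ! i)) [0..<length bs]) \<in> Ops ?P a bs"
      by (rule mact_mem [OF p qqs ne])
    show "?\<alpha> a bs (map concat dsss) (comp_op ?P a (concat css) (concat dsss) p (concat pss)) qs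
        \<in> Ops ?P a bs"
      by (rule mact_mem [OF pp qs ne''])
    fix k assume k: "k \<in> I"
    interpret X: mutual_action "Obj (X k)" "side s (X k)" "side (\<not> s) (X k)"
        "mact s (X k)" "mact (\<not> s) (X k)"
      by (rule bio_mutual [OF bio [OF k]])
    interpret bio_map L "X k" "\<pi> k" by unfold_locales (rule proj [OF k])
    show "smap s (\<pi> k) a bs (?\<alpha> a bs css p
          (map (\<lambda>i. ?\<beta> (bs ! i) (css ! i) (dsss ! i) (qs ! i) (pss ! i)) [0..<length bs])) =
        smap s (\<pi> k) a bs
          (?\<alpha> a bs (map concat dsss) (comp_op ?P a (concat css) (concat dsss) p (concat pss)) qs)"
      using X.linear_act [OF _ _ map_multi_multi_ops [OF pss],
          of "smap s (\<pi> k) a (concat css) p" "obj_map (\<pi> k) a"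
            "mmap (smap (\<not> s) (\<pi> k)) bs (map concat dsss) qs" "map (obj_map (\<pi> k)) bs"]
        map_multi_ops [OF qs] map_op [OF p] ne ne' map_comp [OF p cps] map_multi_mact [OF qs pss' ne']
      unfolding map_mact [OF p qqs ne] map_mact [OF pp qs ne''] mmap_concat [OF pss]
      by (auto simp: map_concat o_def concat_map_concat simp del: nth_map nth_mmap)
  qed
qed

theorem is_bio: "is_bio L"
  by (simp add: is_bio_iff mutual)

text \<open>Each preservation law equates two operations of \<open>L\<close> with the same profile,
  and under every \<open>\<pi> k\<close> it becomes the law for the composite. The values of
  \<open>h\<close> have to be placed in \<open>L\<close> beforehand, since \<open>faithful\<close>
  speaks only of elements of the carriers.\<close>

theorem lift:
  assumes B: "is_bio B"
    and obj: "\<And>c. c \<in> Obj B \<Longrightarrow> obj_map h c \<in> Obj L"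
    and op: "\<And>s c cs p. p \<in> Ops (side s B) c cs \<Longrightarrow>
      smap s h c cs p \<in> Ops (side s L) (obj_map h c) (map (obj_map h) cs)"
    and comp: "\<And>k. k \<in> I \<Longrightarrow> is_bio_map B (X k) (comp_map (\<pi> k) h)"
  shows "is_bio_map B L h"
proof -
  interpret B: pre_bio B by (rule is_bio_pre_bio [OF B])
  have multi: "mmap (smap s h) bs css ps
      \<in> multi_ops (side s L) (map (obj_map h) bs) (map (map (obj_map h)) css)"
    if "ps \<in> multi_ops (side s B) bs css" for s bs css ps
    using that by (auto simp: multi_ops_iff intro!: op)
  have mmap: "mmap (smap s (comp_map (\<pi> k) h)) bs css ps =
      mmap (smap s (\<pi> k)) (map (obj_map h) bs) (map (map (obj_map h)) css) (mmap (smap s h) bs css ps)"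
    if "ps \<in> multi_ops (side s B) bs css" for s k bs css ps
    using that by (intro nth_equalityI) (auto simp: multi_ops_iff)
  show ?thesis
  proof (rule is_bio_mapI)
    fix s c cs p \<sigma>
    assume p: "p \<in> Ops (side s B) c cs" and \<sigma>: "\<sigma> permutes {..<length cs}"
    have \<sigma>': "\<sigma> permutes {..<length (map (obj_map h) cs)}"
      using \<sigma> by simp
    show "smap s h c (permute_list \<sigma> cs) (act (side s B) c cs \<sigma> p) =
        act (side s L) (obj_map h c) (map (obj_map h) cs) \<sigma> (smap s h c cs p)"
    proof (rule faithful)
      show "smap s h c (permute_list \<sigma> cs) (act (side s B) c cs \<sigma> p)
          \<in> Ops (side s L) (obj_map h c) (permute_list \<sigma> (map (obj_map h) cs))"
        using op [OF B.act_mem [OF p \<sigma>]] \<sigma> by (simp add: permute_list_map)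
      show "act (side s L) (obj_map h c) (map (obj_map h) cs) \<sigma> (smap s h c cs p)
          \<in> Ops (side s L) (obj_map h c) (permute_list \<sigma> (map (obj_map h) cs))"
        by (rule act_mem [OF op [OF p] \<sigma>'])
      fix k assume k: "k \<in> I"
      interpret \<pi>: bio_map L "X k" "\<pi> k" by unfold_locales (rule proj [OF k])
      interpret \<xi>: bio_map B "X k" "comp_map (\<pi> k) h" by unfold_locales (rule comp [OF k])
      show "smap s (\<pi> k) (obj_map h c) (permute_list \<sigma> (map (obj_map h) cs))
            (smap s h c (permute_list \<sigma> cs) (act (side s B) c cs \<sigma> p)) =
          smap s (\<pi> k) (obj_map h c) (permute_list \<sigma> (map (obj_map h) cs))
            (act (side s L) (obj_map h c) (map (obj_map h) cs) \<sigma> (smap s h c cs p))"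
        using \<pi>.map_act [OF op [OF p] \<sigma>'] \<xi>.map_act [OF p \<sigma>] \<sigma> by (simp add: permute_list_map)
    qed
  next
    fix s c
    assume c: "c \<in> Obj B"
    show "smap s h c [c] (unit_op (side s B) c) = unit_op (side s L) (obj_map h c)"
    proof (rule faithful)
      show "smap s h c [c] (unit_op (side s B) c) \<in> Ops (side s L) (obj_map h c) [obj_map h c]"
        using op [OF B.unit_mem [OF c]] by simp
      show "unit_op (side s L) (obj_map h c) \<in> Ops (side s L) (obj_map h c) [obj_map h c]"
        by (rule unit_mem [OF obj [OF c]])
      fix k assume k: "k \<in> I"
      interpret \<pi>: bio_map L "X k" "\<pi> k" by unfold_locales (rule proj [OF k])
      interpret \<xi>: bio_map B "X k" "comp_map (\<pi> k) h" by unfold_locales (rule comp [OF k])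
      show "smap s (\<pi> k) (obj_map h c) [obj_map h c] (smap s h c [c] (unit_op (side s B) c)) =
          smap s (\<pi> k) (obj_map h c) [obj_map h c] (unit_op (side s L) (obj_map h c))"
        using \<pi>.map_unit [OF obj [OF c]] \<xi>.map_unit [OF c] by simp
    qed
  next
    fix s a bs css p ps
    assume p: "p \<in> Ops (side s B) a bs" and ps: "ps \<in> multi_ops (side s B) bs css"
    let ?a = "obj_map h a" and ?bs = "map (obj_map h) bs" and ?css = "map (map (obj_map h)) css"
    show "smap s h a (concat css) (comp_op (side s B) a bs css p ps) =
        comp_op (side s L) ?a ?bs ?css (smap s h a bs p) (mmap (smap s h) bs css ps)"
    proof (rule faithful)
      show "smap s h a (concat css) (comp_op (side s B) a bs css p ps)
          \<in> Ops (side s L) ?a (concat ?css)"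
        using op [OF B.comp_mem [OF p ps]] by (simp add: map_concat)
      show "comp_op (side s L) ?a ?bs ?css (smap s h a bs p) (mmap (smap s h) bs css ps)
          \<in> Ops (side s L) ?a (concat ?css)"
        by (rule comp_mem [OF op [OF p] multi [OF ps]])
      fix k assume k: "k \<in> I"
      interpret \<pi>: bio_map L "X k" "\<pi> k" by unfold_locales (rule proj [OF k])
      interpret \<xi>: bio_map B "X k" "comp_map (\<pi> k) h" by unfold_locales (rule comp [OF k])
      show "smap s (\<pi> k) ?a (concat ?css) (smap s h a (concat css) (comp_op (side s B) a bs css p ps)) =
          smap s (\<pi> k) ?a (concat ?css)
            (comp_op (side s L) ?a ?bs ?css (smap s h a bs p) (mmap (smap s h) bs css ps))"
        using \<pi>.map_comp [OF op [OF p] multi [OF ps]] \<xi>.map_comp [OF p ps]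
        by (simp add: mmap [OF ps] map_concat)
    qed
  next
    fix s a bs css p qs
    assume p: "p \<in> Ops (side s B) a (concat css)" and qs: "qs \<in> multi_ops (side (\<not> s) B) bs css"
      and ne: "[] \<notin> set css"
    let ?a = "obj_map h a" and ?bs = "map (obj_map h) bs" and ?css = "map (map (obj_map h)) css"
    have p': "smap s h a (concat css) p \<in> Ops (side s L) ?a (concat ?css)" and ne': "[] \<notin> set ?css"
      using op [OF p] ne by (auto simp: map_concat)
    show "smap s h a bs (mact s B a bs css p qs) =
        mact s L ?a ?bs ?css (smap s h a (concat css) p) (mmap (smap (\<not> s) h) bs css qs)"
    proof (rule faithful)
      show "smap s h a bs (mact s B a bs css p qs) \<in> Ops (side s L) ?a ?bs"
        by (rule op [OF B.mact_mem [OF p qs ne]])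
      show "mact s L ?a ?bs ?css (smap s h a (concat css) p) (mmap (smap (\<not> s) h) bs css qs)
          \<in> Ops (side s L) ?a ?bs"
        by (rule mact_mem [OF p' multi [OF qs] ne'])
      fix k assume k: "k \<in> I"
      interpret \<pi>: bio_map L "X k" "\<pi> k" by unfold_locales (rule proj [OF k])
      interpret \<xi>: bio_map B "X k" "comp_map (\<pi> k) h" by unfold_locales (rule comp [OF k])
      show "smap s (\<pi> k) ?a ?bs (smap s h a bs (mact s B a bs css p qs)) =
          smap s (\<pi> k) ?a ?bs
            (mact s L ?a ?bs ?css (smap s h a (concat css) p) (mmap (smap (\<not> s) h) bs css qs))"
        using \<pi>.map_mact [OF p' multi [OF qs] ne'] \<xi>.map_mact [OF p qs ne]
        by (simp add: mmap [OF qs] map_concat)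
    qed
  qed (fact obj op)+
qed

end

section \<open>Limits\<close>

context diagram
begin

text \<open>Families are total functions in HOL; \<open>extensional\<close> fixes their values off
  \<open>Nodes J\<close>, so that equality of families is equality of components.\<close>

definition lim_obj :: "('i \<Rightarrow> 'c) set" where
  "lim_obj = {x \<in> extensional (Nodes J). (\<forall>i\<in>Nodes J. x i \<in> Obj (D i)) \<and>
    (\<forall>f\<in>Arrows J. obj_map (M f) (x (src J f)) = x (tgt J f))}"

text \<open>The colours must be compatible families in their own right: membership of the components
  says nothing about their values off \<open>Nodes J\<close>, and nothing at all when there are no
  nodes.\<close>

definition lim_ops :: "bool \<Rightarrow> ('i \<Rightarrow> 'c) \<Rightarrow> ('i \<Rightarrow> 'c) list \<Rightarrow> ('i \<Rightarrow> 'o) set" where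
  "lim_ops s x xs = {p \<in> extensional (Nodes J). x \<in> lim_obj \<and> set xs \<subseteq> lim_obj \<and>
    (\<forall>i\<in>Nodes J. p i \<in> Ops (side s (D i)) (x i) (map (\<lambda>y. y i) xs)) \<and>
    (\<forall>f\<in>Arrows J. smap s (M f) (x (src J f)) (map (\<lambda>y. y (src J f)) xs) (p (src J f)) =
      p (tgt J f))}"

definition lim_operad :: "bool \<Rightarrow> ('i \<Rightarrow> 'c, 'i \<Rightarrow> 'o) operad" where
  "lim_operad s =
    \<lparr>Ops = lim_ops s,
     act = (\<lambda>x xs \<sigma> p. \<lambda>i\<in>Nodes J. act (side s (D i)) (x i) (map (\<lambda>y. y i) xs) \<sigma> (p i)),
     unit_op = (\<lambda>x. \<lambda>i\<in>Nodes J. unit_op (side s (D i)) (x i)),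
     comp_op = (\<lambda>x ys zss p ps. \<lambda>i\<in>Nodes J. comp_op (side s (D i)) (x i) (map (\<lambda>y. y i) ys)
       (map (map (\<lambda>z. z i)) zss) (p i) (map (\<lambda>q. q i) ps))\<rparr>"

definition lim :: "('i \<Rightarrow> 'c, 'i \<Rightarrow> 'o) bio" where
  "lim = mk_bio lim_obj lim_operad (\<lambda>s x ys zss p qs. \<lambda>i\<in>Nodes J.
    mact s (D i) (x i) (map (\<lambda>y. y i) ys) (map (map (\<lambda>z. z i)) zss) (p i) (map (\<lambda>q. q i) qs))"

definition lim_proj :: "'i \<Rightarrow> ('i \<Rightarrow> 'c, 'i \<Rightarrow> 'o, 'c, 'o) bio_map" where
  "lim_proj i = mk_map (\<lambda>x. x i) (\<lambda>s x xs p. p i)"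

lemma src_node [simp]: "f \<in> Arrows J \<Longrightarrow> src J f \<in> Nodes J"
  and tgt_node [simp]: "f \<in> Arrows J \<Longrightarrow> tgt J f \<in> Nodes J"
  using src_tgt by auto

lemma bio_node: "i \<in> Nodes J \<Longrightarrow> is_bio (D i)"
  using node by (simp add: closed_bio_iff)

lemma pre_bio_node: "i \<in> Nodes J \<Longrightarrow> pre_bio (D i)"
  by (intro is_bio_pre_bio bio_node)

lemma bio_map_arrow: "f \<in> Arrows J \<Longrightarrow> bio_map (D (src J f)) (D (tgt J f)) (M f)"
  by unfold_locales (rule arrow)

lemma lim_simps [simp]:
  "Obj lim = lim_obj"
  "Ops (side s lim) = lim_ops s"
  "act (side s lim) x xs \<sigma> p =
    (\<lambda>i\<in>Nodes J. act (side s (D i)) (x i) (map (\<lambda>y. y i) xs) \<sigma> (p i))"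
  "unit_op (side s lim) x = (\<lambda>i\<in>Nodes J. unit_op (side s (D i)) (x i))"
  "comp_op (side s lim) x ys zss p ps =
    (\<lambda>i\<in>Nodes J. comp_op (side s (D i)) (x i) (map (\<lambda>y. y i) ys)
      (map (map (\<lambda>z. z i)) zss) (p i) (map (\<lambda>q. q i) ps))"
  "mact s lim x ys zss p ps =
    (\<lambda>i\<in>Nodes J. mact s (D i) (x i) (map (\<lambda>y. y i) ys)
      (map (map (\<lambda>z. z i)) zss) (p i) (map (\<lambda>q. q i) ps))"
  by (simp_all add: lim_def lim_operad_def)

lemma lim_objD:
  assumes "x \<in> lim_obj"
  shows "x \<in> extensional (Nodes J)" "i \<in> Nodes J \<Longrightarrow> x i \<in> Obj (D i)"
    "f \<in> Arrows J \<Longrightarrow> obj_map (M f) (x (src J f)) = x (tgt J f)"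
  using assms by (auto simp: lim_obj_def)

lemma lim_opsD:
  assumes "p \<in> lim_ops s x xs"
  shows "x \<in> lim_obj" "set xs \<subseteq> lim_obj" "p \<in> extensional (Nodes J)"
    "i \<in> Nodes J \<Longrightarrow> p i \<in> Ops (side s (D i)) (x i) (map (\<lambda>y. y i) xs)"
    "f \<in> Arrows J \<Longrightarrow>
      smap s (M f) (x (src J f)) (map (\<lambda>y. y (src J f)) xs) (p (src J f)) = p (tgt J f)"
  using assms by (auto simp: lim_ops_def)

lemma lim_opsI:
  assumes "x \<in> lim_obj" "set xs \<subseteq> lim_obj" "p \<in> extensional (Nodes J)"
    "\<And>i. i \<in> Nodes J \<Longrightarrow> p i \<in> Ops (side s (D i)) (x i) (map (\<lambda>y. y i) xs)"
    "\<And>f. f \<in> Arrows J \<Longrightarrow>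
      smap s (M f) (x (src J f)) (map (\<lambda>y. y (src J f)) xs) (p (src J f)) = p (tgt J f)"
  shows "p \<in> lim_ops s x xs"
  using assms by (auto simp: lim_ops_def)

lemma arrow_word:
  assumes "f \<in> Arrows J" "set xs \<subseteq> lim_obj"
  shows "map (obj_map (M f) \<circ> (\<lambda>y. y (src J f))) xs = map (\<lambda>y. y (tgt J f)) xs"
  using assms lim_objD(3) by auto

lemma arrow_words:
  assumes "f \<in> Arrows J" "\<And>zs. zs \<in> set zss \<Longrightarrow> set zs \<subseteq> lim_obj"
  shows "map (map (obj_map (M f) \<circ> (\<lambda>y. y (src J f)))) zss = map (map (\<lambda>y. y (tgt J f))) zss"
  using assms by (simp add: arrow_word)

text \<open>Reads a family of operations of the limit at a node and along an arrow, which turns it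
  into input for the closure of \<open>D i\<close> and for preservation by
  \<open>M f\<close>.\<close>

lemma multi_lim:
  assumes "ps \<in> multi_ops (side s lim) ys zss"
  shows "i \<in> Nodes J \<Longrightarrow>
      map (\<lambda>q. q i) ps \<in> multi_ops (side s (D i)) (map (\<lambda>y. y i) ys) (map (map (\<lambda>z. z i)) zss)"
    and "f \<in> Arrows J \<Longrightarrow>
      mmap (smap s (M f)) (map (\<lambda>y. y (src J f)) ys) (map (map (\<lambda>z. z (src J f))) zss)
        (map (\<lambda>q. q (src J f)) ps) = map (\<lambda>q. q (tgt J f)) ps"
    and "\<And>y. y \<in> set ys \<Longrightarrow> y \<in> lim_obj"
    and "\<And>zs. zs \<in> set zss \<Longrightarrow> set zs \<subseteq> lim_obj"
proof -
  have len: "length zss = length ys" "length ps = length ys"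
    and mem: "\<And>j. j < length ys \<Longrightarrow> ps ! j \<in> lim_ops s (ys ! j) (zss ! j)"
    using multi_opsD [OF assms] by auto
  show "i \<in> Nodes J \<Longrightarrow>
      map (\<lambda>q. q i) ps \<in> multi_ops (side s (D i)) (map (\<lambda>y. y i) ys) (map (map (\<lambda>z. z i)) zss)"
    using len lim_opsD(4) [OF mem] by (simp add: multi_ops_iff)
  show "f \<in> Arrows J \<Longrightarrow>
      mmap (smap s (M f)) (map (\<lambda>y. y (src J f)) ys) (map (map (\<lambda>z. z (src J f))) zss)
        (map (\<lambda>q. q (src J f)) ps) = map (\<lambda>q. q (tgt J f)) ps"
    using len lim_opsD(5) [OF mem] by (intro nth_equalityI) simp_all
  show "y \<in> lim_obj" if "y \<in> set ys" for y
    using that lim_opsD(1) [OF mem] by (metis in_set_conv_nth)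
  show "set zs \<subseteq> lim_obj" if "zs \<in> set zss" for zs
    using that lim_opsD(2) [OF mem] len by (metis in_set_conv_nth)
qed

text \<open>Membership at a node is closure of \<open>D i\<close>. Compatibility along an arrow
  holds because \<open>M f\<close> preserves the structure map in question and takes the components
  at the source of \<open>f\<close> to those at the target.\<close>

lemma pre_bio_lim: "pre_bio lim"
proof
  fix s
  show "x \<in> Obj lim \<and> set xs \<subseteq> Obj lim" if "p \<in> Ops (side s lim) x xs" for p x xs
    using that by (simp add: lim_opsD)
  show "act (side s lim) x xs \<sigma> p \<in> Ops (side s lim) x (permute_list \<sigma> xs)"
    if "p \<in> Ops (side s lim) x xs" and \<sigma>: "\<sigma> permutes {..<length xs}" for p x xs \<sigma>
  proof -
    have p: "p \<in> lim_ops s x xs"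
      using that by simp
    show ?thesis unfolding lim_simps
    \<comment> \<open>Of the five premises of \<open>lim_opsI\<close>, the fourth is membership at a
      node and the fifth compatibility along an arrow.\<close>
    proof (rule lim_opsI, goal_cases)
      case (4 i)
      then show ?case
        using pre_bio.act_mem [OF pre_bio_node lim_opsD(4) [OF p], of i \<sigma>] \<sigma>
        by (simp add: permute_list_map)
    next
      case (5 f)
      then show ?case
        using bio_map.map_act [OF bio_map_arrow lim_opsD(4) [OF p], of f \<sigma>] \<sigma>
          lim_opsD [OF p] arrow_word [of f xs]
        by (simp add: permute_list_map lim_objD)
    qed (use lim_opsD [OF p] \<sigma> in auto)
  qed
  show "unit_op (side s lim) x \<in> Ops (side s lim) x [x]" if "x \<in> Obj lim" for x
    unfolding lim_simps
  proof (rule lim_opsI, goal_cases)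
    case (4 i)
    then show ?case
      using that pre_bio.unit_mem [OF pre_bio_node, of i] by (simp add: lim_objD)
  next
    case (5 f)
    then show ?case
      using that bio_map.map_unit [OF bio_map_arrow, of f] by (simp add: lim_objD)
  qed (use that in auto)
  show "comp_op (side s lim) x ys zss p ps \<in> Ops (side s lim) x (concat zss)"
    if "p \<in> Ops (side s lim) x ys" and ps: "ps \<in> multi_ops (side s lim) ys zss" for p x ys zss ps
  proof -
    have p: "p \<in> lim_ops s x ys"
      using that by simp
    show ?thesis unfolding lim_simps
    proof (rule lim_opsI, goal_cases)
      case (4 i)
      then show ?case
        using pre_bio.comp_mem [OF pre_bio_node lim_opsD(4) [OF p] multi_lim(1) [OF ps], of i]
        by (simp add: map_concat)
    next
      case (5 f)
      then show ?case
        using bio_map.map_comp [OF bio_map_arrow lim_opsD(4) [OF p] multi_lim(1) [OF ps], of f]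
          lim_opsD [OF p] arrow_word [of f ys] arrow_words [of f zss, OF _ multi_lim(4) [OF ps]]
        by (simp add: map_concat lim_objD multi_lim(2) [OF ps])
    qed (use lim_opsD [OF p] in \<open>auto dest: subsetD [OF multi_lim(4) [OF ps]]\<close>)
  qed
  show "mact s lim x ys zss p qs \<in> Ops (side s lim) x ys"
    if "p \<in> Ops (side s lim) x (concat zss)" and qs: "qs \<in> multi_ops (side (\<not> s) lim) ys zss"
      and ne: "[] \<notin> set zss" for p x zss qs ys
  proof -
    have p: "p \<in> lim_ops s x (concat zss)"
      using that by simp
    have p': "p i \<in> Ops (side s (D i)) (x i) (concat (map (map (\<lambda>z. z i)) zss))"
      if "i \<in> Nodes J" for i
      using lim_opsD(4) [OF p that] by (simp add: map_concat)
    have ne': "[] \<notin> set (map (map (\<lambda>z. z i)) zss)" for i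
      using ne by auto
    show ?thesis unfolding lim_simps
    proof (rule lim_opsI, goal_cases)
      case (4 i)
      then show ?case
        using pre_bio.mact_mem [OF pre_bio_node p' multi_lim(1) [OF qs] ne', of i] by simp
    next
      case (5 f)
      then show ?case
        using bio_map.map_mact [OF bio_map_arrow p' multi_lim(1) [OF qs] ne', of f]
          lim_opsD [OF p] arrow_word [of f ys] arrow_words [of f zss, OF _ multi_lim(4) [OF qs]]
          multi_lim(3) [OF qs]
        by (simp add: map_concat lim_objD multi_lim(2) [OF qs] subset_iff)
    qed (use lim_opsD [OF p] multi_lim(3) [OF qs] in auto)
  qed
qed

section \<open>Projections and universal property of the limit\<close>

lemma lim_proj_bio_map:
  assumes "i \<in> Nodes J"
  shows "is_bio_map lim (D i) (lim_proj i)"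
proof (rule is_bio_mapI)
  have multi: "mmap (\<lambda>x xs p. p i) ys zss ps = map (\<lambda>q. q i) ps"
    if "ps \<in> multi_ops (side s lim) ys zss" for s ys zss ps
    using multi_opsD [OF that] by (intro nth_equalityI) simp_all
  show "smap s (lim_proj i) x (concat zss) (comp_op (side s lim) x ys zss p ps) =
      comp_op (side s (D i)) (obj_map (lim_proj i) x) (map (obj_map (lim_proj i)) ys)
        (map (map (obj_map (lim_proj i))) zss) (smap s (lim_proj i) x ys p)
        (mmap (smap s (lim_proj i)) ys zss ps)"
    if "ps \<in> multi_ops (side s lim) ys zss" for s x ys zss p ps
    using multi [OF that] assms by (simp add: lim_proj_def)
  show "smap s (lim_proj i) x ys (mact s lim x ys zss p qs) =
      mact s (D i) (obj_map (lim_proj i) x) (map (obj_map (lim_proj i)) ys)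
        (map (map (obj_map (lim_proj i))) zss) (smap s (lim_proj i) x (concat zss) p)
        (mmap (smap (\<not> s) (lim_proj i)) ys zss qs)"
    if "qs \<in> multi_ops (side (\<not> s) lim) ys zss" for s x ys zss p qs
    using multi [OF that] assms by (simp add: lim_proj_def)
qed (use assms in \<open>simp_all add: lim_proj_def lim_objD lim_opsD\<close>)

sublocale lim: jointly_faithful lim "Nodes J" D lim_proj
proof (intro jointly_faithful.intro pre_bio_lim jointly_faithful_axioms.intro bio_node lim_proj_bio_map)
  fix p q s x xs
  assume "p \<in> Ops (side s lim) x xs" "q \<in> Ops (side s lim) x xs"
    and "\<And>i. i \<in> Nodes J \<Longrightarrow> smap s (lim_proj i) x xs p = smap s (lim_proj i) x xs q"
  then show "p = q"
    by (intro extensionalityI [of p "Nodes J"]) (simp_all add: lim_proj_def lim_opsD)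
qed

text \<open>At each node the nullary set is a single point, and \<open>M f\<close> has no choice but
  to send one point to the other, so the unique family of these points is compatible.\<close>

lemma closed_bio_lim: "closed_bio lim"
  unfolding closed_bio_iff
proof (intro conjI ballI allI lim.is_bio)
  fix x s
  assume "x \<in> Obj lim"
  then have x: "x \<in> lim_obj"
    by simp
  have one: "\<exists>p. Ops (side s (D i)) (x i) [] = {p}" if "i \<in> Nodes J" for i
    using node [OF that] lim_objD(2) [OF x that] by (auto simp: closed_bio_iff is_singleton_def)
  then obtain p where p: "\<And>i. i \<in> Nodes J \<Longrightarrow> Ops (side s (D i)) (x i) [] = {p i}"
    by metis
  have "smap s (M f) (x (src J f)) [] (p (src J f)) = p (tgt J f)" if "f \<in> Arrows J" for f
    using bio_map.map_op [OF bio_map_arrow [OF that], of "p (src J f)" s "x (src J f)" "[]"]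
      p [of "src J f"] p [of "tgt J f"] lim_objD(3) [OF x that] that by simp
  then have "lim_ops s x [] = {restrict p (Nodes J)}"
    using p x by (auto simp: lim_ops_def fun_eq_iff extensional_def)
  then show "is_singleton (Ops (side s lim) x [])"
    by simp
qed

lemma is_cone_lim: "is_cone J D M lim lim_proj"
  unfolding is_cone_def
proof (intro conjI ballI closed_bio_lim lim_proj_bio_map)
  show "map_eq lim (comp_map (M f) (lim_proj (src J f))) (lim_proj (tgt J f))"
    if "f \<in> Arrows J" for f
    using that by (auto simp: map_eq_iff lim_proj_def lim_objD lim_opsD)
qed

definition lim_tuple :: "('i \<Rightarrow> ('x, 'y, 'c, 'o) bio_map) \<Rightarrow> ('x, 'y, 'i \<Rightarrow> 'c, 'i \<Rightarrow> 'o) bio_map" where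
  "lim_tuple \<xi> = mk_map (\<lambda>c. \<lambda>i\<in>Nodes J. obj_map (\<xi> i) c) (\<lambda>s c cs p. \<lambda>i\<in>Nodes J. smap s (\<xi> i) c cs p)"

lemma lim_tuple_bio_map:
  assumes "is_cone J D M X \<xi>"
  shows "is_bio_map X lim (lim_tuple \<xi>)"
proof (rule lim.lift)
  have \<xi>: "bio_map X (D i) (\<xi> i)" if "i \<in> Nodes J" for i
    using assms that by (simp add: is_cone_def bio_map_def)
  have eq: "map_eq X (comp_map (M f) (\<xi> (src J f))) (\<xi> (tgt J f))" if "f \<in> Arrows J" for f
    using assms that by (simp add: is_cone_def)
  show X: "is_bio X"
    using assms by (simp add: is_cone_def closed_bio_iff)
  show obj: "obj_map (lim_tuple \<xi>) c \<in> Obj lim" if "c \<in> Obj X" for c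
    using that eq by (auto simp: lim_tuple_def lim_obj_def bio_map.map_obj [OF \<xi>] map_eq_iff)
  show "smap s (lim_tuple \<xi>) c cs p
      \<in> Ops (side s lim) (obj_map (lim_tuple \<xi>) c) (map (obj_map (lim_tuple \<xi>)) cs)"
    if p: "p \<in> Ops (side s X) c cs" for s c cs p
    unfolding lim_simps
  proof (rule lim_opsI, goal_cases)
    case (4 i)
    then show ?case
      using bio_map.map_op [OF \<xi> p, of i] by (simp add: lim_tuple_def o_def)
  next
    case (5 f)
    then show ?case
      using eq [of f] p by (simp add: lim_tuple_def o_def map_eq_iff)
  qed (use pre_bio.ops_colours [OF is_bio_pre_bio [OF X] p] obj in \<open>auto simp: lim_tuple_def\<close>)
  show "is_bio_map X (D i) (comp_map (lim_proj i) (lim_tuple \<xi>))" if i: "i \<in> Nodes J" for i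
  proof -
    \<comment> \<open>At a node the composite equals \<open>\<xi> i\<close> as a record, junk values
      included, so the property transfers without passing through \<open>map_eq\<close>.\<close>
    have "comp_map (lim_proj i) (lim_tuple \<xi>) = \<xi> i"
      using i by (simp add: comp_map_def lim_proj_def lim_tuple_def mk_map_def o_def smap_def)
    then show ?thesis
      using \<xi> [OF i] by (simp add: bio_map_def)
  qed
qed

text \<open>The types of the test object do not occur in the construction and stay arbitrary.
  Uniqueness rests on \<open>extensional\<close>: the components of a mediating map are prescribed
  at the nodes, and landing in the carriers fixes the rest.\<close>

theorem is_limit_lim: "is_limit TYPE(('x, 'y) bio) J D M lim lim_proj"
  unfolding is_limit_def
proof (intro conjI allI impI is_cone_lim)
  fix X :: "('x, 'y) bio" and \<xi>
  assume cone: "is_cone J D M X \<xi>"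
  show "\<exists>h. is_bio_map X lim h \<and> (\<forall>i\<in>Nodes J. map_eq X (comp_map (lim_proj i) h) (\<xi> i)) \<and>
      (\<forall>h'. is_bio_map X lim h' \<and> (\<forall>i\<in>Nodes J. map_eq X (comp_map (lim_proj i) h') (\<xi> i)) \<longrightarrow>
        map_eq X h h')"
  proof (intro exI [of _ "lim_tuple \<xi>"] conjI allI impI ballI lim_tuple_bio_map [OF cone])
    show "map_eq X (comp_map (lim_proj i) (lim_tuple \<xi>)) (\<xi> i)" if "i \<in> Nodes J" for i
      using that by (simp add: map_eq_iff lim_proj_def lim_tuple_def)
    fix h'
    assume h': "is_bio_map X lim h' \<and> (\<forall>i\<in>Nodes J. map_eq X (comp_map (lim_proj i) h') (\<xi> i))"
    then interpret h': bio_map X lim h'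
      by (simp add: bio_map_def)
    show "map_eq X (lim_tuple \<xi>) h'"
      unfolding map_eq_iff
    proof (intro conjI ballI allI)
      show "obj_map (lim_tuple \<xi>) c = obj_map h' c" if "c \<in> Obj X" for c
        using that h' h'.map_obj [OF that]
        by (intro extensionalityI [of _ "Nodes J"])
          (auto simp: map_eq_iff lim_proj_def lim_tuple_def lim_objD)
      show "smap s (lim_tuple \<xi>) c cs p = smap s h' c cs p" if "p \<in> Ops (side s X) c cs" for s c cs p
        using that h' h'.map_op [OF that]
        by (intro extensionalityI [of _ "Nodes J"])
          (auto simp: map_eq_iff lim_proj_def lim_tuple_def lim_opsD)
    qed
  qed
qed

end

section \<open>Coding terms by words\<close>

text \<open>One constructor per rule of \<open>gen\<close>. The sign is supplied at evaluation, and
  a permutation is recorded by its finitely many relevant values, so a term is finite data over the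
  elements of the diagram.\<close>

datatype ('i, 'c, 'o) tm =
    Leg 'i 'c "'c list" 'o
  | Perm "nat list" "('i, 'c, 'o) tm"
  | Comp "('i, 'c, 'o) tm" "('i, 'c, 'o) tm list"
  | Mut "('i, 'c, 'o) tm" "('i, 'c, 'o) tm list"

text \<open>A prefix code: the leading tag names the constructor, and the number after it tells how
  many colours, positions or arguments the constructor has. Numbers sit on the left of the sum;
  elements of the diagram, marked with their node, on the right.\<close>

primrec flat :: "('i, 'c, 'o) tm \<Rightarrow> (nat + 'i \<times> ('c + 'o)) list" where
  "flat (Leg i c cs p) =
    Inl 0 # Inl (length cs) # Inr (i, Inr p) # Inr (i, Inl c) # map (\<lambda>c. Inr (i, Inl c)) cs"
| "flat (Perm ns t) = Inl 1 # Inl (length ns) # map Inl ns @ flat t"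
| "flat (Comp t ts) = Inl 2 # Inl (length ts) # flat t @ concat (map flat ts)"
| "flat (Mut t ts) = Inl 3 # Inl (length ts) # flat t @ concat (map flat ts)"

text \<open>The common length is read off the header of a word. With equally many codes on both
  sides, they can be cancelled from the left one at a time.\<close>

lemma concat_map_flat_prefix_free:
  assumes "\<And>t t' r r'. t \<in> set ts \<Longrightarrow> flat t @ r = flat t' @ r' \<Longrightarrow> t = t' \<and> r = r'"
    and "length ts = length ts'" "concat (map flat ts) @ r = concat (map flat ts') @ r'"
  shows "ts = ts' \<and> r = r'"
  using assms(2,1,3)
proof (induction ts ts' rule: list_induct2)
  case (Cons t ts t' ts')
  have "t = t' \<and> concat (map flat ts) @ r = concat (map flat ts') @ r'"
    using Cons.prems(2) by (intro Cons.prems(1)) simp_all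
  moreover have "concat (map flat ts) @ r = concat (map flat ts') @ r' \<Longrightarrow> ts = ts' \<and> r = r'"
    using Cons.prems(1) by (intro Cons.IH) (meson list.set_intros(2))+
  ultimately show ?case by blast
qed simp

text \<open>Injectivity alone does not pass through concatenated subterms; with arbitrary remainders
  \<open>r\<close> and \<open>r'\<close> the induction hypothesis also tells where each subterm
  ends.\<close>

lemma flat_prefix_free: "flat t @ r = flat t' @ r' \<Longrightarrow> t = t' \<and> r = r'"
proof (induction t arbitrary: t' r r')
  case (Leg i c cs p)
  then show ?case
    by (cases t') (auto simp: append_eq_append_conv inj_map_eq_map inj_def)
next
  case (Perm ns t)
  then obtain ns' u where t': "t' = Perm ns' u"
    by (cases t') auto
  have "ns = ns'" "flat t @ r = flat u @ r'"
    using Perm.prems by (auto simp: t' append_eq_append_conv inj_map_eq_map)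
  with Perm.IH show ?case
    by (simp add: t')
next
  case (Comp t ts)
  then obtain u us where t': "t' = Comp u us"
    by (cases t') auto
  have len: "length ts = length us" and "flat t @ concat (map flat ts) @ r = flat u @ concat (map flat us) @ r'"
    using Comp.prems by (auto simp: t')
  then have "t = u" "concat (map flat ts) @ r = concat (map flat us) @ r'"
    using Comp.IH(1) by blast+
  with concat_map_flat_prefix_free [OF Comp.IH(2) len] show ?case
    by (simp add: t')
next
  case (Mut t ts)
  then obtain u us where t': "t' = Mut u us"
    by (cases t') auto
  have len: "length ts = length us" and "flat t @ concat (map flat ts) @ r = flat u @ concat (map flat us) @ r'"
    using Mut.prems by (auto simp: t')
  then have "t = u" "concat (map flat ts) @ r = concat (map flat us) @ r'"
    using Mut.IH(1) by blast+
  with concat_map_flat_prefix_free [OF Mut.IH(2) len] show ?case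
    by (simp add: t')
qed

lemma inj_flat: "inj flat"
  using flat_prefix_free [where r = "[]" and r' = "[]"] by (auto intro: injI)


section \<open>The bio generated by a cocone\<close>

text \<open>The types of \<open>P\<close> are free because the construction is used twice: for the
  product of all cocones on the fixed carriers, and for a test cocone whose generated part has to be
  copied onto these carriers.\<close>

locale cocone = diagram J D M
  for J :: "('i, 'a) cat" and D :: "'i \<Rightarrow> ('c, 'o) bio" and M :: "'a \<Rightarrow> ('c, 'o, 'c, 'o) bio_map" +
  fixes P :: "('x, 'y) bio" and \<xi> :: "'i \<Rightarrow> ('c, 'o, 'x, 'y) bio_map"
  assumes cocone: "is_cocone J D M P \<xi>"
begin

lemma closed_bio_P: "closed_bio P"
  using cocone by (simp add: is_cocone_def)

lemma is_bio_P: "is_bio P"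
  using closed_bio_P by (simp add: closed_bio_iff)

sublocale P: pre_bio P
  by (rule is_bio_pre_bio [OF is_bio_P])

lemma bio_map_leg: "i \<in> Nodes J \<Longrightarrow> bio_map (D i) P (\<xi> i)"
  using cocone by (simp add: is_cocone_def bio_map_def)

lemma cocone_arrow:
  "f \<in> Arrows J \<Longrightarrow> map_eq (D (src J f)) (comp_map (\<xi> (tgt J f)) (M f)) (\<xi> (src J f))"
  using cocone by (simp add: is_cocone_def)

definition colours :: "'x set" where
  "colours = (\<Union>i\<in>Nodes J. obj_map (\<xi> i) ` Obj (D i))"

text \<open>
  Units and nullary operations need no rule: they are images of those in the diagram, the latter
  because the bios are closed.
\<close>

inductive gen :: "bool \<Rightarrow> 'x \<Rightarrow> 'x list \<Rightarrow> 'y \<Rightarrow> bool" where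
  gen_leg: "\<lbrakk>i \<in> Nodes J; p \<in> Ops (side s (D i)) c cs\<rbrakk> \<Longrightarrow>
    gen s (obj_map (\<xi> i) c) (map (obj_map (\<xi> i)) cs) (smap s (\<xi> i) c cs p)"
| gen_act: "\<lbrakk>gen s c cs p; \<sigma> permutes {..<length cs}\<rbrakk> \<Longrightarrow>
    gen s c (permute_list \<sigma> cs) (act (side s P) c cs \<sigma> p)"
| gen_comp: "\<lbrakk>gen s a bs p; length css = length bs; length ps = length bs;
      \<And>j. j < length bs \<Longrightarrow> gen s (bs ! j) (css ! j) (ps ! j)\<rbrakk> \<Longrightarrow>
    gen s a (concat css) (comp_op (side s P) a bs css p ps)"
| gen_mact: "\<lbrakk>gen s a (concat css) p; length css = length bs; length qs = length bs;
      \<And>j. j < length bs \<Longrightarrow> gen (\<not> s) (bs ! j) (css ! j) (qs ! j); [] \<notin> set css\<rbrakk> \<Longrightarrow>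
    gen s a bs (mact s P a bs css p qs)"

lemma gen_ops: "gen s c cs p \<Longrightarrow> p \<in> Ops (side s P) c cs \<and> c \<in> colours \<and> set cs \<subseteq> colours"
proof (induction rule: gen.induct)
  case (gen_leg i p s c cs)
  then show ?case
    using bio_map.map_op [OF bio_map_leg, of i p s c cs]
      pre_bio.ops_colours [OF pre_bio_node, of i p s c cs]
    by (auto simp: colours_def)
next
  case (gen_act s c cs p \<sigma>)
  then show ?case
    by (simp add: P.act_mem)
next
  case (gen_comp s a bs p css ps)
  moreover have "ps \<in> multi_ops (side s P) bs css"
    using gen_comp by (simp add: multi_ops_iff)
  moreover have "set cs \<subseteq> colours" if "cs \<in> set css" for cs
    using that gen_comp by (metis in_set_conv_nth)
  ultimately show ?case
    by (auto simp: P.comp_mem)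
next
  case (gen_mact s a css p bs qs)
  moreover have "qs \<in> multi_ops (side (\<not> s) P) bs css"
    using gen_mact by (simp add: multi_ops_iff)
  moreover have "b \<in> colours" if "b \<in> set bs" for b
    using that gen_mact by (metis in_set_conv_nth)
  ultimately show ?case
    by (auto simp: P.mact_mem)
qed

lemma gen_unit:
  assumes "c \<in> colours"
  shows "gen s c [c] (unit_op (side s P) c)"
proof -
  obtain i d where i: "i \<in> Nodes J" and d: "d \<in> Obj (D i)" and c: "c = obj_map (\<xi> i) d"
    using assms by (auto simp: colours_def)
  show ?thesis
    using gen_leg [OF i pre_bio.unit_mem [OF pre_bio_node [OF i] d, of s]]
      bio_map.map_unit [OF bio_map_leg [OF i] d, of s] by (simp add: c)
qed

text \<open>
  A term determines its profile; terms that are not well-typed receive junk values.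
\<close>

primrec ev :: "('i, 'c, 'o) tm \<Rightarrow> bool \<Rightarrow> 'x \<times> 'x list \<times> 'y" where
  "ev (Leg i c cs p) =
    (\<lambda>s. (obj_map (\<xi> i) c, map (obj_map (\<xi> i)) cs, smap s (\<xi> i) c cs p))"
| "ev (Perm ns t) = (\<lambda>s. case ev t s of (c, cs, p) \<Rightarrow>
    let \<sigma> = (\<lambda>k. if k < length ns then ns ! k else k)
    in (c, permute_list \<sigma> cs, act (side s P) c cs \<sigma> p))"
| "ev (Comp t ts) = (\<lambda>s. case ev t s of (a, bs, p) \<Rightarrow>
    let es = map (\<lambda>e. e s) (map ev ts); css = map (fst \<circ> snd) es
    in (a, concat css, comp_op (side s P) a bs css p (map (snd \<circ> snd) es)))"
| "ev (Mut t ts) = (\<lambda>s. case ev t s of (a, _, p) \<Rightarrow>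
    let es = map (\<lambda>e. e (\<not> s)) (map ev ts); bs = map fst es; css = map (fst \<circ> snd) es
    in (a, bs, mact s P a bs css p (map (snd \<circ> snd) es)))"

lemma obtain_terms:
  assumes "length css = length bs" "length ps = length bs"
    "\<And>j. j < length bs \<Longrightarrow> \<exists>t. ev t s = (bs ! j, css ! j, ps ! j)"
  obtains ts where "map (\<lambda>t. fst (ev t s)) ts = bs" "map (\<lambda>t. fst (snd (ev t s))) ts = css"
    "map (\<lambda>t. snd (snd (ev t s))) ts = ps"
proof -
  obtain t where t: "\<And>j. j < length bs \<Longrightarrow> ev (t j) s = (bs ! j, css ! j, ps ! j)"
    using assms(3) by metis
  show thesis
    using assms(1,2) t by (intro that [of "map t [0..<length bs]"]; intro nth_equalityI; simp)
qed

text \<open>A term for every generated element is what bounds the size of the generated part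
  independently of \<open>P\<close>. For \<open>gen_mact\<close> the arguments have the opposite
  sign, which is the sign at which \<open>Mut\<close> evaluates them.\<close>

lemma gen_ev: "gen s c cs p \<Longrightarrow> \<exists>t. ev t s = (c, cs, p)"
proof (induction rule: gen.induct)
  case (gen_leg i p s c cs)
  show ?case
    by (rule exI [of _ "Leg i c cs p"]) simp
next
  case (gen_act s c cs p \<sigma>)
  then obtain t where t: "ev t s = (c, cs, p)"
    by blast
  \<comment> \<open>A term keeps only the values on the word; beyond it the identity is the right
    completion because \<open>\<sigma>\<close> permutes the positions.\<close>
  have "(\<lambda>k. if k < length cs then map \<sigma> [0..<length cs] ! k else k) = \<sigma>"
    using permutes_not_in [OF gen_act.hyps(2)] by auto
  then show ?case
    by (intro exI [of _ "Perm (map \<sigma> [0..<length cs]) t"]) (simp add: t)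
next
  case (gen_comp s a bs p css ps)
  then obtain t ts where "ev t s = (a, bs, p)" "map (\<lambda>t. fst (ev t s)) ts = bs"
    "map (\<lambda>t. fst (snd (ev t s))) ts = css" "map (\<lambda>t. snd (snd (ev t s))) ts = ps"
    using obtain_terms [of css bs ps s] by metis
  then show ?case
    by (intro exI [of _ "Comp t ts"]) (simp add: o_def)
next
  case (gen_mact s a css p bs qs)
  then obtain t ts where "ev t s = (a, concat css, p)" "map (\<lambda>t. fst (ev t (\<not> s))) ts = bs"
    "map (\<lambda>t. fst (snd (ev t (\<not> s)))) ts = css" "map (\<lambda>t. snd (snd (ev t (\<not> s)))) ts = qs"
    using obtain_terms [of css bs qs "\<not> s"] by metis
  then show ?case
    by (intro exI [of _ "Mut t ts"]) (simp add: o_def)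
qed

text \<open>Choosing one term per element replaces a quotient of terms by equality of value. Sign
  and profile enter the choice because one value of type \<open>'y\<close> may belong to several
  sets \<open>Ops\<close>.\<close>

definition code :: "bool \<Rightarrow> 'x \<Rightarrow> 'x list \<Rightarrow> 'y \<Rightarrow> (nat + 'i \<times> ('c + 'o)) list" where
  "code s c cs p = flat (SOME t. ev t s = (c, cs, p))"

definition decode :: "bool \<Rightarrow> (nat + 'i \<times> ('c + 'o)) list \<Rightarrow> 'y" where
  "decode s w = snd (snd (ev (inv flat w) s))"

lemma decode_code:
  assumes "gen s c cs p"
  shows "decode s (code s c cs p) = p"
  using someI_ex [OF gen_ev [OF assms]] by (simp add: code_def decode_def inv_f_f [OF inj_flat])

text \<open>A colour may come from several nodes; one preimage is chosen, so that the colours of the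
  copy live in \<open>'i \<times> 'c\<close> and \<open>col\<close> recovers the original.\<close>

definition rep :: "'x \<Rightarrow> 'i \<times> 'c" where
  "rep x = (SOME (i, c). i \<in> Nodes J \<and> c \<in> Obj (D i) \<and> obj_map (\<xi> i) c = x)"

definition col :: "'i \<times> 'c \<Rightarrow> 'x" where
  "col a = obj_map (\<xi> (fst a)) (snd a)"

lemma col_rep [simp]: "x \<in> colours \<Longrightarrow> col (rep x) = x"
proof -
  assume "x \<in> colours"
  then have "\<exists>a. case a of (i, c) \<Rightarrow> i \<in> Nodes J \<and> c \<in> Obj (D i) \<and> obj_map (\<xi> i) c = x"
    by (auto simp: colours_def)
  then have "case rep x of (i, c) \<Rightarrow> i \<in> Nodes J \<and> c \<in> Obj (D i) \<and> obj_map (\<xi> i) c = x"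
    unfolding rep_def by (rule someI_ex)
  then show ?thesis
    by (auto simp: col_def split: prod.splits)
qed

lemma map_col_rep [simp]: "set xs \<subseteq> colours \<Longrightarrow> map (col \<circ> rep) xs = xs"
  by (induction xs) auto

lemma maps_col_rep [simp]: "(\<And>xs. xs \<in> set xss \<Longrightarrow> set xs \<subseteq> colours) \<Longrightarrow> map (map (col \<circ> rep)) xss = xss"
  by (induction xss) auto

text \<open>The last condition keeps only the chosen words. It makes \<open>decode\<close> injective
  on each profile, so that terms with equal value are not told apart.\<close>

definition hull_ops :: "bool \<Rightarrow> 'i \<times> 'c \<Rightarrow> ('i \<times> 'c) list \<Rightarrow> (nat + 'i \<times> ('c + 'o)) list set" where
  "hull_ops s a as = {w. a \<in> rep ` colours \<and> set as \<subseteq> rep ` colours \<and>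
    gen s (col a) (map col as) (decode s w) \<and> code s (col a) (map col as) (decode s w) = w}"

definition hull_operad :: "bool \<Rightarrow> ('i \<times> 'c, (nat + 'i \<times> ('c + 'o)) list) operad" where
  "hull_operad s =
    \<lparr>Ops = hull_ops s,
     act = (\<lambda>a as \<sigma> w. code s (col a) (map col (permute_list \<sigma> as))
       (act (side s P) (col a) (map col as) \<sigma> (decode s w))),
     unit_op = (\<lambda>a. code s (col a) [col a] (unit_op (side s P) (col a))),
     comp_op = (\<lambda>a bs css w ws. code s (col a) (map col (concat css))
       (comp_op (side s P) (col a) (map col bs) (map (map col) css) (decode s w) (map (decode s) ws)))\<rparr>"

text \<open>The type mentions only \<open>'i\<close>, \<open>'c\<close> and \<open>'o\<close>:
  wherever \<open>P\<close> lives, its generated part is copied onto the same carriers.\<close>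

definition hull :: "('i, 'c, 'o) colimit_bio" where
  "hull = mk_bio (rep ` colours) hull_operad (\<lambda>s a bs css w ws. code s (col a) (map col bs)
    (mact s P (col a) (map col bs) (map (map col) css) (decode s w) (map (decode (\<not> s)) ws)))"

definition hull_leg :: "'i \<Rightarrow> ('c, 'o, 'i \<times> 'c, (nat + 'i \<times> ('c + 'o)) list) bio_map" where
  "hull_leg i = mk_map (rep \<circ> obj_map (\<xi> i))
    (\<lambda>s c cs p. code s (obj_map (\<xi> i) c) (map (obj_map (\<xi> i)) cs) (smap s (\<xi> i) c cs p))"

definition hull_incl :: "('i \<times> 'c, (nat + 'i \<times> ('c + 'o)) list, 'x, 'y) bio_map" where
  "hull_incl = mk_map col (\<lambda>s a as. decode s)"

lemma hull_simps [simp]: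
  "Obj hull = rep ` colours"
  "Ops (side s hull) = hull_ops s"
  "act (side s hull) a as \<sigma> w = code s (col a) (map col (permute_list \<sigma> as))
    (act (side s P) (col a) (map col as) \<sigma> (decode s w))"
  "unit_op (side s hull) a = code s (col a) [col a] (unit_op (side s P) (col a))"
  "comp_op (side s hull) a bs css w ws = code s (col a) (map col (concat css))
    (comp_op (side s P) (col a) (map col bs) (map (map col) css) (decode s w) (map (decode s) ws))"
  "mact s hull a bs css w ws = code s (col a) (map col bs)
    (mact s P (col a) (map col bs) (map (map col) css) (decode s w) (map (decode (\<not> s)) ws))"
  by (simp_all add: hull_def hull_operad_def)

lemma hull_incl_simps [simp]: "obj_map hull_incl = col" "smap s hull_incl a as = decode s"
  by (simp_all add: hull_incl_def)

lemma hull_leg_simps [simp]: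
  "obj_map (hull_leg i) = rep \<circ> obj_map (\<xi> i)"
  "smap s (hull_leg i) c cs p =
    code s (obj_map (\<xi> i) c) (map (obj_map (\<xi> i)) cs) (smap s (\<xi> i) c cs p)"
  by (simp_all add: hull_leg_def)

lemma hull_opsD:
  assumes "w \<in> hull_ops s a as"
  shows "a \<in> rep ` colours" "set as \<subseteq> rep ` colours" "gen s (col a) (map col as) (decode s w)"
    "code s (col a) (map col as) (decode s w) = w"
  using assms by (auto simp: hull_ops_def)

lemma code_mem:
  assumes "gen s (col a) (map col as) p" "a \<in> rep ` colours" "set as \<subseteq> rep ` colours"
  shows "code s (col a) (map col as) p \<in> hull_ops s a as"
  using assms by (simp add: hull_ops_def decode_code)

lemma code_mem_rep:
  assumes "gen s c cs p"
  shows "code s c cs p \<in> hull_ops s (rep c) (map rep cs)"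
  using code_mem [of s "rep c" "map rep cs" p] gen_ops [OF assms] assms by auto

lemma multi_hull:
  assumes "ws \<in> multi_ops (side s hull) bs css"
  shows "length css = length bs" "length ws = length bs"
    "\<And>j. j < length bs \<Longrightarrow> gen s (map col bs ! j) (map (map col) css ! j) (map (decode s) ws ! j)"
    "b \<in> set bs \<Longrightarrow> b \<in> rep ` colours" "cs \<in> set css \<Longrightarrow> set cs \<subseteq> rep ` colours"
proof -
  show len: "length css = length bs" "length ws = length bs"
    using multi_opsD [OF assms] by auto
  have mem: "ws ! j \<in> hull_ops s (bs ! j) (css ! j)" if "j < length bs" for j
    using multi_opsD [OF assms] that by simp
  show "gen s (map col bs ! j) (map (map col) css ! j) (map (decode s) ws ! j)"
    if "j < length bs" for j
    using hull_opsD(3) [OF mem [OF that]] that len by simp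
  show "b \<in> set bs \<Longrightarrow> b \<in> rep ` colours"
    using hull_opsD(1) [OF mem] by (metis in_set_conv_nth)
  show "cs \<in> set css \<Longrightarrow> set cs \<subseteq> rep ` colours"
    using hull_opsD(2) [OF mem] len by (metis in_set_conv_nth)
qed

text \<open>Structure maps applied to codes give generated elements of \<open>P\<close>. This
  licenses \<open>decode_code\<close>, and with it both closure of the copy and preservation by
  \<open>hull_incl\<close>.\<close>

lemma hull_gen_act:
  assumes "w \<in> hull_ops s a as" "\<sigma> permutes {..<length as}"
  shows "gen s (col a) (map col (permute_list \<sigma> as))
    (act (side s P) (col a) (map col as) \<sigma> (decode s w))"
  using gen_act [OF hull_opsD(3) [OF assms(1)], of \<sigma>] assms(2) by (simp add: permute_list_map)

lemma hull_gen_comp: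
  assumes "w \<in> hull_ops s a bs" "ws \<in> multi_ops (side s hull) bs css"
  shows "gen s (col a) (map col (concat css))
    (comp_op (side s P) (col a) (map col bs) (map (map col) css) (decode s w) (map (decode s) ws))"
  using gen_comp [OF hull_opsD(3) [OF assms(1)], of "map (map col) css" "map (decode s) ws"]
    multi_hull(1,2,3) [OF assms(2)]
  by (simp add: map_concat)

lemma hull_gen_mact:
  assumes "w \<in> hull_ops s a (concat css)" "ws \<in> multi_ops (side (\<not> s) hull) bs css" "[] \<notin> set css"
  shows "gen s (col a) (map col bs)
    (mact s P (col a) (map col bs) (map (map col) css) (decode s w) (map (decode (\<not> s)) ws))"
  using gen_mact [of s "col a" "map (map col) css" "decode s w" "map col bs" "map (decode (\<not> s)) ws"]
    hull_opsD(3) [OF assms(1)] multi_hull(1,2,3) [OF assms(2)] assms(3)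
  by (auto simp: map_concat)

lemma pre_bio_hull: "pre_bio hull"
proof
  fix s
  show "a \<in> Obj hull \<and> set as \<subseteq> Obj hull" if "w \<in> Ops (side s hull) a as" for w a as
    using that hull_opsD(1,2) by simp
  show "act (side s hull) a as \<sigma> w \<in> Ops (side s hull) a (permute_list \<sigma> as)"
    if "w \<in> Ops (side s hull) a as" "\<sigma> permutes {..<length as}" for w a as \<sigma>
    using that hull_opsD(1,2) [of w s a as] by (auto intro!: code_mem hull_gen_act)
  show "unit_op (side s hull) a \<in> Ops (side s hull) a [a]" if "a \<in> Obj hull" for a
    using that code_mem [of s a "[a]"] gen_unit by auto
  show "comp_op (side s hull) a bs css w ws \<in> Ops (side s hull) a (concat css)"
    if "w \<in> Ops (side s hull) a bs" "ws \<in> multi_ops (side s hull) bs css" for w a bs ws css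
    using that hull_opsD(1) [of w s a bs] subsetD [OF multi_hull(5) [OF that(2)]]
    unfolding hull_simps by (intro code_mem hull_gen_comp) auto
  show "mact s hull a bs css w ws \<in> Ops (side s hull) a bs"
    if "w \<in> Ops (side s hull) a (concat css)" "ws \<in> multi_ops (side (\<not> s) hull) bs css"
      "[] \<notin> set css" for w a bs ws css
    using that hull_opsD(1) [of w s a "concat css"] multi_hull(4) [OF that(2)]
    unfolding hull_simps by (intro code_mem hull_gen_mact) auto
qed

lemma mmap_decode:
  "ws \<in> multi_ops (side s hull) bs css \<Longrightarrow> mmap (\<lambda>a as. decode s) bs css ws = map (decode s) ws"
  by (intro nth_equalityI) (auto simp: multi_ops_iff)

lemma smap_hull_incl: "smap s hull_incl = (\<lambda>a as. decode s)"
  by (simp add: fun_eq_iff)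

lemma hull_incl_bio_map: "is_bio_map hull P hull_incl"
proof (rule is_bio_mapI)
  show "obj_map hull_incl a \<in> Obj P" if "a \<in> Obj hull" for a
    using that bio_map.map_obj [OF bio_map_leg] by (auto simp: colours_def [symmetric])
      (auto simp: colours_def)
  show "smap s hull_incl a as w \<in> Ops (side s P) (obj_map hull_incl a) (map (obj_map hull_incl) as)"
    if "w \<in> Ops (side s hull) a as" for s a as w
    using gen_ops [OF hull_opsD(3)] that by simp
  show "smap s hull_incl a (permute_list \<sigma> as) (act (side s hull) a as \<sigma> w) =
      act (side s P) (obj_map hull_incl a) (map (obj_map hull_incl) as) \<sigma> (smap s hull_incl a as w)"
    if "w \<in> Ops (side s hull) a as" "\<sigma> permutes {..<length as}" for s a as w \<sigma>
    using that by (simp add: decode_code hull_gen_act)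
  show "smap s hull_incl a [a] (unit_op (side s hull) a) = unit_op (side s P) (obj_map hull_incl a)"
    if "a \<in> Obj hull" for s a
    using that by (auto intro!: decode_code gen_unit)
  show "smap s hull_incl a (concat css) (comp_op (side s hull) a bs css w ws) =
      comp_op (side s P) (obj_map hull_incl a) (map (obj_map hull_incl) bs)
        (map (map (obj_map hull_incl)) css) (smap s hull_incl a bs w) (mmap (smap s hull_incl) bs css ws)"
    if "w \<in> Ops (side s hull) a bs" "ws \<in> multi_ops (side s hull) bs css" for s a bs css w ws
    using decode_code [OF hull_gen_comp] mmap_decode that
    by (simp add: smap_hull_incl)
  show "smap s hull_incl a bs (mact s hull a bs css w ws) =
      mact s P (obj_map hull_incl a) (map (obj_map hull_incl) bs)
        (map (map (obj_map hull_incl)) css) (smap s hull_incl a (concat css) w)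
        (mmap (smap (\<not> s) hull_incl) bs css ws)"
    if "w \<in> Ops (side s hull) a (concat css)" "ws \<in> multi_ops (side (\<not> s) hull) bs css"
      "[] \<notin> set css" for s a bs css w ws
    using decode_code [OF hull_gen_mact] mmap_decode that
    by (simp add: smap_hull_incl)
qed

text \<open>A single map is faithful by itself, because a word in the carrier is recovered as the
  code of its value.\<close>

sublocale hull: jointly_faithful hull "{()}" "\<lambda>_. P" "\<lambda>_. hull_incl"
proof (intro jointly_faithful.intro pre_bio_hull jointly_faithful_axioms.intro is_bio_P hull_incl_bio_map)
  fix w w' s a as
  assume w: "w \<in> Ops (side s hull) a as" "w' \<in> Ops (side s hull) a as"
    and "\<And>k. k \<in> {()} \<Longrightarrow> smap s hull_incl a as w = smap s hull_incl a as w'"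
  then have "decode s w = decode s w'"
    by simp
  then show "w = w'"
    using w hull_opsD(4) by (metis hull_simps(2))
qed

section \<open>The generated part as a closed cocone\<close>

lemma leg_colours: "i \<in> Nodes J \<Longrightarrow> c \<in> Obj (D i) \<Longrightarrow> obj_map (\<xi> i) c \<in> colours"
  by (auto simp: colours_def)

text \<open>Decoding is known to invert coding on generated elements, hence the equality on the
  source of the leg.\<close>

lemma hull_incl_leg: "i \<in> Nodes J \<Longrightarrow> map_eq (D i) (comp_map hull_incl (hull_leg i)) (\<xi> i)"
  by (simp add: map_eq_iff leg_colours decode_code gen_leg)

lemma hull_leg_bio_map:
  assumes i: "i \<in> Nodes J"
  shows "is_bio_map (D i) hull (hull_leg i)"
proof (rule hull.lift [OF bio_node [OF i]])
  show "obj_map (hull_leg i) c \<in> Obj hull" if "c \<in> Obj (D i)" for c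
    using leg_colours [OF i that] by simp
  show "smap s (hull_leg i) c cs p
      \<in> Ops (side s hull) (obj_map (hull_leg i) c) (map (obj_map (hull_leg i)) cs)"
    if "p \<in> Ops (side s (D i)) c cs" for s c cs p
    using code_mem_rep [OF gen_leg [OF i that]] by simp
  show "is_bio_map (D i) P (comp_map hull_incl (hull_leg i))"
    by (rule is_bio_map_cong [OF bio_node [OF i] bio_map.is_bio_map [OF bio_map_leg [OF i]]
          hull_incl_leg [OF i]])
qed

text \<open>Every colour comes from a leg, so the nullary element of that \<open>D i\<close> has an
  image. Any two nullary words decode into a one-point set of \<open>P\<close>, so they are the same
  code.\<close>

lemma closed_bio_hull: "closed_bio hull"
  unfolding closed_bio_iff
proof (intro conjI ballI allI hull.is_bio)
  fix b s
  assume "b \<in> Obj hull"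
  then obtain i c where i: "i \<in> Nodes J" and c: "c \<in> Obj (D i)" and b: "b = rep (obj_map (\<xi> i) c)"
    by (auto simp: colours_def)
  obtain p where "p \<in> Ops (side s (D i)) c []"
    using node [OF i] c by (force simp: closed_bio_iff is_singleton_def)
  from code_mem_rep [OF gen_leg [OF i this]] obtain w where w: "w \<in> hull_ops s b []"
    by (auto simp: b)
  have "is_singleton (Ops (side s P) (col b) [])"
    using closed_bio_P bio_map.map_obj [OF bio_map_leg [OF i] c] leg_colours [OF i c]
    by (simp add: closed_bio_iff b)
  then obtain q where q: "Ops (side s P) (col b) [] = {q}"
    by (auto simp: is_singleton_def)
  have "v = w" if v: "v \<in> hull_ops s b []" for v
    using gen_ops [OF hull_opsD(3) [OF v]] gen_ops [OF hull_opsD(3) [OF w]]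
      hull_opsD(4) [OF v] hull_opsD(4) [OF w] q by simp
  then have "hull_ops s b [] = {w}"
    using w by blast
  then show "is_singleton (Ops (side s hull) b [])"
    by simp
qed

lemma is_cocone_hull: "is_cocone J D M hull hull_leg"
  unfolding is_cocone_def
proof (intro conjI ballI closed_bio_hull hull_leg_bio_map)
  fix f
  assume f: "f \<in> Arrows J"
  \<comment> \<open>Codes depend on the profile as well as on the value, so the cocone equations are
    needed for both.\<close>
  have "map (obj_map (\<xi> (tgt J f)) \<circ> obj_map (M f)) cs = map (obj_map (\<xi> (src J f))) cs"
    "obj_map (\<xi> (tgt J f)) (obj_map (M f) c) = obj_map (\<xi> (src J f)) c"
    if "p \<in> Ops (side s (D (src J f))) c cs" for s c cs p
    using cocone_arrow [OF f] pre_bio.ops_colours [OF pre_bio_node that] f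
    by (auto simp: map_eq_iff)
  note word = this
  show "map_eq (D (src J f)) (comp_map (hull_leg (tgt J f)) (M f)) (hull_leg (src J f))"
    unfolding map_eq_iff
  proof (intro conjI ballI allI)
    show "smap s (comp_map (hull_leg (tgt J f)) (M f)) c cs p = smap s (hull_leg (src J f)) c cs p"
      if "p \<in> Ops (side s (D (src J f))) c cs" for s c cs p
      using cocone_arrow [OF f] word [OF that] that by (simp add: map_eq_iff del: map_eq_conv)
  qed (use cocone_arrow [OF f] in \<open>simp add: map_eq_iff\<close>)
qed

text \<open>The legs generate: the elements on which \<open>g\<close> and \<open>h\<close> agree
  include the images of the legs and are closed under every rule of \<open>gen\<close>, since both
  maps preserve the structure.\<close>

lemma hull_maps_eq:
  assumes g: "is_bio_map hull X g" and h: "is_bio_map hull X h"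
    and eq: "\<And>i. i \<in> Nodes J \<Longrightarrow> map_eq (D i) (comp_map g (hull_leg i)) (comp_map h (hull_leg i))"
  shows "map_eq hull g h"
proof -
  interpret g: bio_map hull X g by unfold_locales (rule g)
  interpret h: bio_map hull X h by unfold_locales (rule h)
  have obj: "obj_map g (rep x) = obj_map h (rep x)" if "x \<in> colours" for x
    using that eq by (auto simp: colours_def map_eq_iff)
  have word: "map (obj_map g \<circ> rep) xs = map (obj_map h \<circ> rep) xs" if "set xs \<subseteq> colours" for xs
    using that obj by auto
  have "smap s g (rep c) (map rep cs) (code s c cs p) = smap s h (rep c) (map rep cs) (code s c cs p)"
    if "gen s c cs p" for s c cs p
    using that
  proof (induction rule: gen.induct)
    case (gen_leg i p s c cs)
    then show ?case
      using eq [of i] by (simp add: map_eq_iff)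
  next
    case (gen_act s c cs p \<sigma>)
    have mem: "code s c cs p \<in> Ops (side s hull) (rep c) (map rep cs)"
      using code_mem_rep [OF gen_act.hyps(1)] by simp
    have \<sigma>: "\<sigma> permutes {..<length (map rep cs)}"
      using gen_act by simp
    \<comment> \<open>The code of the result is rewritten as the structure map of
      \<open>hull\<close> applied to a code, the form to which preservation by \<open>g\<close> and
      \<open>h\<close> applies.\<close>
    have "code s c (permute_list \<sigma> cs) (act (side s P) c cs \<sigma> p) =
        act (side s hull) (rep c) (map rep cs) \<sigma> (code s c cs p)"
      using gen_ops [OF gen_act.hyps(1)] gen_act.hyps
      by (simp add: decode_code permute_list_map [symmetric])
    then show ?case
      using g.map_act [OF mem \<sigma>] h.map_act [OF mem \<sigma>] gen_act word gen_ops [OF gen_act.hyps(1)] obj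
      by (simp add: permute_list_map del: hull_simps)
  next
    case (gen_comp s a bs p css ps)
    have a: "a \<in> colours" "set bs \<subseteq> colours"
      using gen_ops [OF gen_comp.hyps(1)] by auto
    have css: "set cs \<subseteq> colours" if "cs \<in> set css" for cs
      using that gen_ops [OF gen_comp.hyps(4)] gen_comp.hyps(2) by (metis in_set_conv_nth)
    have mem: "code s a bs p \<in> Ops (side s hull) (rep a) (map rep bs)"
      using code_mem_rep [OF gen_comp.hyps(1)] by simp
    have mems: "mmap (code s) bs css ps \<in> multi_ops (side s hull) (map rep bs) (map (map rep) css)"
      using gen_comp by (simp add: multi_ops_iff code_mem_rep)
    have dec: "map (decode s) (mmap (code s) bs css ps) = ps"
      using gen_comp by (intro nth_equalityI) (simp_all add: decode_code)
    have code: "code s a (concat css) (comp_op (side s P) a bs css p ps) =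
        comp_op (side s hull) (rep a) (map rep bs) (map (map rep) css) (code s a bs p)
          (mmap (code s) bs css ps)"
      using a css gen_comp.hyps(1) by (simp add: decode_code dec map_concat)
    have IH: "mmap (smap s g) (map rep bs) (map (map rep) css) (mmap (code s) bs css ps) =
        mmap (smap s h) (map rep bs) (map (map rep) css) (mmap (code s) bs css ps)"
      using gen_comp by (intro nth_equalityI) simp_all
    have "map (map (obj_map g \<circ> rep)) css = map (map (obj_map h \<circ> rep)) css"
      using obj css by (auto simp: subset_iff)
    then show ?case
      using g.map_comp [OF mem mems] h.map_comp [OF mem mems] gen_comp.IH(1) IH obj [OF a(1)]
        word [OF a(2)]
      by (simp add: code map_concat del: hull_simps map_eq_conv)
  next
    case (gen_mact s a css p bs qs)
    have a: "a \<in> colours"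
      using gen_ops [OF gen_mact.hyps(1)] by auto
    have bs: "set bs \<subseteq> colours"
      using gen_ops [OF gen_mact.hyps(4)] by (metis in_set_conv_nth subsetI)
    have css: "set cs \<subseteq> colours" if "cs \<in> set css" for cs
      using that gen_ops [OF gen_mact.hyps(4)] gen_mact.hyps(2) by (metis in_set_conv_nth)
    have mem: "code s a (concat css) p \<in> Ops (side s hull) (rep a) (concat (map (map rep) css))"
      using code_mem_rep [OF gen_mact.hyps(1)] by (simp add: map_concat)
    have mems: "mmap (code (\<not> s)) bs css qs
        \<in> multi_ops (side (\<not> s) hull) (map rep bs) (map (map rep) css)"
      using gen_mact by (simp add: multi_ops_iff code_mem_rep)
    have ne: "[] \<notin> set (map (map rep) css)"
      using gen_mact by auto
    have dec: "map (decode (\<not> s)) (mmap (code (\<not> s)) bs css qs) = qs"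
      using gen_mact by (intro nth_equalityI) (simp_all add: decode_code)
    have code: "code s a bs (mact s P a bs css p qs) =
        mact s hull (rep a) (map rep bs) (map (map rep) css) (code s a (concat css) p)
          (mmap (code (\<not> s)) bs css qs)"
      using a bs css gen_mact.hyps(1) by (simp add: decode_code dec)
    have IH: "mmap (smap (\<not> s) g) (map rep bs) (map (map rep) css) (mmap (code (\<not> s)) bs css qs) =
        mmap (smap (\<not> s) h) (map rep bs) (map (map rep) css) (mmap (code (\<not> s)) bs css qs)"
      using gen_mact by (intro nth_equalityI) simp_all
    have "map (map (obj_map g \<circ> rep)) css = map (map (obj_map h \<circ> rep)) css"
      using obj css by (auto simp: subset_iff)
    then show ?case
      using g.map_mact [OF mem mems ne] h.map_mact [OF mem mems ne] gen_mact.IH(1) IH obj [OF a]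
        word [OF bs]
      by (simp add: code map_concat del: hull_simps map_eq_conv)
  qed
  note ops = this
  show ?thesis
    unfolding map_eq_iff
  proof (intro conjI ballI allI)
    show "obj_map g c = obj_map h c" if "c \<in> Obj hull" for c
      using that obj by auto
    show "smap s g a as w = smap s h a as w" if "w \<in> Ops (side s hull) a as" for s a as w
    proof -
      have w: "w \<in> hull_ops s a as"
        using that by simp
      \<comment> \<open>Objects of the copy are themselves representatives, so every profile in
        \<open>hull\<close> has the form covered by the induction.\<close>
      have rc: "rep (col b) = b" if "b \<in> rep ` colours" for b
        using that by auto
      have "map (rep \<circ> col) as = as"
        using rc hull_opsD(2) [OF w] by (induction as) auto
      then show ?thesis
        using ops [OF hull_opsD(3) [OF w]] hull_opsD(4) [OF w] rc [OF hull_opsD(1) [OF w]] by simp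
    qed
  qed
qed

end


section \<open>Colimits\<close>

text \<open>Products are limits over a category with identities only; naming each identity by its
  object lets the limit construction be reused.\<close>

definition discrete :: "'k set \<Rightarrow> ('k, 'k) cat" where
  "discrete K = \<lparr>Nodes = K, Arrows = K, src = (\<lambda>k. k), tgt = (\<lambda>k. k), id_arr = (\<lambda>k. k),
    comp_arr = (\<lambda>g f. f)\<rparr>"

lemma discrete_simps [simp]:
  "Nodes (discrete K) = K" "Arrows (discrete K) = K" "src (discrete K) k = k" "tgt (discrete K) k = k"
  by (simp_all add: discrete_def)

lemma diagram_discrete:
  assumes "\<And>k. k \<in> K \<Longrightarrow> closed_bio (D k)"
  shows "diagram (discrete K) D (\<lambda>_. id_map)"
  by unfold_locales (use assms in \<open>auto simp: discrete_def is_bio_map_id map_eq_iff\<close>)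

context diagram
begin

text \<open>The solution set of the adjoint functor argument. Both components have types fixed by
  the diagram, so these cocones form a set and can index a product.\<close>

definition small_cocones ::
    "(('i, 'c, 'o) colimit_bio \<times> ('i \<Rightarrow> ('c, 'o, 'i \<times> 'c, (nat + 'i \<times> ('c + 'o)) list) bio_map)) set"
  where "small_cocones = {(B, \<zeta>). is_cocone J D M B \<zeta>}"

interpretation small: diagram "discrete small_cocones" fst "\<lambda>_. id_map"
  by (rule diagram_discrete) (auto simp: small_cocones_def is_cocone_def)

definition small_leg where "small_leg i = small.lim_tuple (\<lambda>(B, \<zeta>). \<zeta> i)"

text \<open>A cocone on a product is a family of cocones: its legs are tuples, and the triangle of
  an arrow is checked in each factor.\<close>

lemma is_cocone_small: "is_cocone J D M small.lim small_leg"
  unfolding is_cocone_def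
proof (intro conjI ballI small.closed_bio_lim)
  fix i assume i: "i \<in> Nodes J"
  show "is_bio_map (D i) small.lim (small_leg i)"
    unfolding small_leg_def
    by (rule small.lim_tuple_bio_map)
      (use i node in \<open>auto simp: is_cone_def small_cocones_def is_cocone_def map_eq_iff\<close>)
next
  fix f assume f: "f \<in> Arrows J"
  then have "map_eq (D (src J f)) (comp_map (\<zeta> (tgt J f)) (M f)) (\<zeta> (src J f))"
    if "(B, \<zeta>) \<in> small_cocones" for B \<zeta>
    using that by (simp add: small_cocones_def is_cocone_def)
  then show "map_eq (D (src J f)) (comp_map (small_leg (tgt J f)) (M f)) (small_leg (src J f))"
    by (auto simp: map_eq_iff small_leg_def small.lim_tuple_def fun_eq_iff restrict_def)
qed

text \<open>The product lives on functions of small cocones, not on the prescribed carrier types;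
  its generated part returns to \<open>colimit_bio\<close>.\<close>

interpretation colim: cocone J D M small.lim small_leg
  by unfold_locales (rule is_cocone_small)

theorem is_colimit_hull: "is_colimit TYPE(('x, 'y) bio) J D M colim.hull colim.hull_leg"
  unfolding is_colimit_def
proof (intro conjI allI impI colim.is_cocone_hull)
  fix X :: "('x, 'y) bio" and \<xi>
  assume "is_cocone J D M X \<xi>"
  then interpret X: cocone J D M X \<xi>
    by unfold_locales
  let ?k = "(X.hull, X.hull_leg)"
  have k: "?k \<in> Nodes (discrete small_cocones)"
    using X.is_cocone_hull by (simp add: small_cocones_def)
  \<comment> \<open>An element of the colimit is read in the product, projected to the factor copied
    from \<open>X\<close> and decoded there. The detour through \<open>X.hull\<close> is forced
    because \<open>X\<close> itself has its own types and is no factor.\<close>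
  define h where "h = comp_map X.hull_incl (comp_map (small.lim_proj ?k) colim.hull_incl)"
  have "is_bio_map small.lim X.hull (small.lim_proj ?k)"
    using small.lim_proj_bio_map [OF k] by simp
  then have bio: "is_bio_map colim.hull X h"
    unfolding h_def by (intro is_bio_map_comp [OF X.hull_incl_bio_map]
        is_bio_map_comp [OF _ colim.hull_incl_bio_map])
  have leg: "map_eq (D i) (comp_map h (colim.hull_leg i)) (\<xi> i)" if i: "i \<in> Nodes J" for i
    using colim.hull_incl_leg [OF i] X.hull_incl_leg [OF i] k
    by (auto simp: map_eq_iff h_def small.lim_proj_def small_leg_def small.lim_tuple_def)
  show "\<exists>h. is_bio_map colim.hull X h \<and>
      (\<forall>i\<in>Nodes J. map_eq (D i) (comp_map h (colim.hull_leg i)) (\<xi> i)) \<and>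
      (\<forall>h'. is_bio_map colim.hull X h' \<and>
        (\<forall>i\<in>Nodes J. map_eq (D i) (comp_map h' (colim.hull_leg i)) (\<xi> i)) \<longrightarrow>
        map_eq colim.hull h h')"
  proof (intro exI [of _ h] conjI allI impI ballI bio leg)
    fix h'
    assume h': "is_bio_map colim.hull X h' \<and>
      (\<forall>i\<in>Nodes J. map_eq (D i) (comp_map h' (colim.hull_leg i)) (\<xi> i))"
    show "map_eq colim.hull h h'"
      by (rule colim.hull_maps_eq [OF bio]) (use h' leg in \<open>auto simp: map_eq_iff\<close>)
  qed
qed

end

theorem corollary1:
  fixes J :: "('i, 'a) cat"
    and D :: "'i \<Rightarrow> ('c, 'o) bio"
    and M :: "'a \<Rightarrow> ('c, 'o, 'c, 'o) bio_map"
  assumes "diagram J D M"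
  shows "(\<exists>(L :: ('i, 'c, 'o) limit_bio) \<pi>.
            is_limit TYPE(('i, 'c, 'o) limit_bio) J D M L \<pi> \<and>
            is_limit TYPE(('x, 'y) bio) J D M L \<pi>) \<and>
         (\<exists>(L :: ('i, 'c, 'o) colimit_bio) \<iota>.
            is_colimit TYPE(('i, 'c, 'o) colimit_bio) J D M L \<iota> \<and>
            is_colimit TYPE(('x, 'y) bio) J D M L \<iota>)"
proof -
  interpret diagram J D M by (rule assms)
  show ?thesis
    \<comment> \<open>Both test types are instances of the same polymorphic theorems, so a single
      witness serves the two conjuncts in each half.\<close>
    by (intro conjI exI; rule is_limit_lim is_colimit_hull)
qed

end
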